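(* Consider the delayed Cucker–Smale system with symmetric weights $$\dot x_i(t)=v_i(t),\qquad \dot v_i(t)=\frac{\lambda}{N}\sum_{\substack{j=1\\ j\neq i}}^N\psi_{ij}(t-\tau(t))\,\bigl(v_j(t-\tau(t))-v_i(t)\bigr),\qquad i=1,\dots,N,$$ under the assumptions listed in the context. Assume the structural condition: there exists $\gamma>0$ such that $\mu(t)\ge\gamma$ for all $t>0$, where $\mu(t)$ is the smallest positive eigenvalue of the Laplacian matrix $L(t)$ defined in the context, taken along the solution. Set $$\tau_0=\frac{\gamma^2}{2\lambda^2}\,\frac{1-c}{2\lambda^2+\gamma^2}.$$ If $\overline\tau^2e^{\overline\tau}\in(0,\tau_0)$, then every solution of the system satisfies $$V(t)\le C e^{-rt},\qquad t\ge0,$$ with $$r=\min\left\{\gamma-4\,\frac{\lambda^2}{\gamma}\,\frac{\lambda^2\overline\tau^2}{(1-c)e^{-\overline\tau}-2\lambda^2\overline\tau^2}\,,\ 1\right\},$$ $$C=V(0)+\frac{\lambda^2\overline\tau}{\gamma N}\,\frac{1}{(1-c)e^{-\overline\tau}-2\lambda^2\overline\tau^2}\int_{-\tau(0)}^0e^{s}\int_s^0\sum_{i=1}^N|\dot v_i(\sigma)|^2\,d\sigma\,ds .$$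
   Context: Setting. $N\in\mathbb{N}$ is the number of agents, $\lambda\ge0$ is a coupling strength, and $|\cdot|$ is the Euclidean norm on $\mathbb{R}^d$. For $i=1,\dots,N$, $x_i(t),v_i(t)\in\mathbb{R}^d$ are the position and velocity of the $i$-th agent. Delay. The delay $\tau(t)>0$ is time-varying and bounded: there exists $\overline\tau>0$ such that $0\le\tau(t)\le\overline\tau$ for all $t>0$. The function $t\mapsto\tau(t)$ is almost everywhere differentiable, and there exists $c>0$ such that $|\tau'(t)|\le c<1$ for all $t>0$. Weights. $\psi_{ij}(t)=\psi(|x_i(t)-x_j(t)|)$ for $i,j\in\{1,\dots,N\}$, where the potential $\psi:[0,+\infty)\to(0,+\infty)$ is continuous and bounded, and $\psi_{ij}(t)\le1$ for all $t\in[-\tau(0),+\infty)$ and all $i,j$. Initial data. $x_i(t)=f_i(t)$ and $v_i(t)=g_i(t)$ for $t\in[-\tau(0),0]$, where $f_i,g_i:[-\tau(0),0]\to\mathbb{R}^d$ are given functions. Velocity variance. $V(t)=\frac{1}{2N^2}\sum_{i,j=1}^N|v_i(t)-v_j(t)|^2$. Laplacian matrix. $L(t)=(L_{ij}(t))$ is the symmetric $N\times N$ matrix with $L_{ij}(t)=-\frac{\lambda}{N}\psi_{ij}(t)$ for $i\ne j$ and $L_{ii}(t)=\frac{\lambda}{N}\sum_{j\ne i}\psi_{ij}(t)$. Its eigenvalues are nonnegative and its smallest eigenvalue is $0$; $\mu(t)$ denotes its smallest positive eigenvalue (Fiedler number).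
   Formalization: The condition μ(t) ≥ γ is required for all t > -τ(0), not only t > 0 (the claim fails otherwise); τ is taken locally absolutely continuous on [0,∞), and the initial velocities g_i absolutely continuous with square-integrable derivative. *)

theory Defs
  imports "HOL-Analysis.Analysis"
begin

text \<open>
  Agents are indexed by a finite type \<open>'n\<close>, so the number of agents is \<open>N = CARD('n)\<close>;
  the ambient space is \<open>real ^ 'd\<close> with its Euclidean norm.  The trajectories
  \<open>x, v :: 'n \<Rightarrow> real \<Rightarrow> real ^ 'd\<close> are total functions, but only their values on
  \<open>{- \<tau> 0..}\<close> matter.
\<close>

text \<open>
  Absolute continuity on \<open>[a, b]\<close>, in the form given by Lebesgue's fundamental theorem of
  calculus: \<open>h\<close> is differentiable almost everywhere, its derivative is Lebesgue integrable, and
  \<open>h\<close> is recovered from it.  (Where \<open>h\<close> is not differentiable, \<open>vector_derivative\<close> has an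
  unspecified value; this concerns a null set only.)
\<close>

definition abs_cont_on :: "real \<Rightarrow> real \<Rightarrow> (real \<Rightarrow> 'a::euclidean_space) \<Rightarrow> bool" where
  "abs_cont_on a b h \<longleftrightarrow>
     (AE s in lebesgue. s \<in> {a..b} \<longrightarrow> h differentiable (at s)) \<and>
     (\<lambda>s. vector_derivative h (at s)) absolutely_integrable_on {a..b} \<and>
     (\<forall>s\<in>{a..b}. h s = h a + integral {a..s} (\<lambda>\<sigma>. vector_derivative h (at \<sigma>)))"

text \<open>
  The bound on the derivative of the delay is imposed almost everywhere, and \<open>\<tau>\<close> is locally
  absolutely continuous: equivalently, \<open>\<tau>\<close> is Lipschitz with constant \<open>c\<close> on \<open>[0, \<infinity>)\<close>.
  Without absolute continuity the bound on the derivative would not prevent jumps of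
  \<open>\<tau>\<close>, and \<open>t - \<tau> t\<close> could leave the domain \<open>[- \<tau> 0, \<infinity>)\<close> of the trajectories.
\<close>

definition admissible_delay :: "real \<Rightarrow> real \<Rightarrow> (real \<Rightarrow> real) \<Rightarrow> bool" where
  "admissible_delay \<tau>bar c \<tau> \<longleftrightarrow>
     (\<forall>t>0. 0 \<le> \<tau> t \<and> \<tau> t \<le> \<tau>bar) \<and>
     (\<forall>T>0. abs_cont_on 0 T \<tau>) \<and>
     (AE t in lebesgue. 0 < t \<longrightarrow> \<bar>deriv \<tau> t\<bar> \<le> c)"

definition admissible_potential :: "(real \<Rightarrow> real) \<Rightarrow> bool" where
  "admissible_potential \<psi> \<longleftrightarrow>
     continuous_on {0..} \<psi> \<and> bounded (\<psi> ` {0..}) \<and> (\<forall>s\<ge>0. 0 < \<psi> s)"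

definition weight ::
    "(real \<Rightarrow> real) \<Rightarrow> ('n \<Rightarrow> real \<Rightarrow> real ^ 'd) \<Rightarrow> 'n \<Rightarrow> 'n \<Rightarrow> real \<Rightarrow> real" where
  "weight \<psi> x i j t = \<psi> (norm (x i t - x j t))"

text \<open>
  The velocity data \<open>g\<close> are absolutely continuous with square integrable derivative, which is
  what gives a meaning to the \<open>v'\<close>-integral over \<open>[- \<tau> 0, 0]\<close> in the decay estimate.  No
  regularity of \<open>f\<close> and no relation between \<open>f\<close> and \<open>g\<close> is required.
\<close>

definition admissible_velocity_data ::
    "(real \<Rightarrow> real) \<Rightarrow> ('n::finite \<Rightarrow> real \<Rightarrow> real ^ 'd) \<Rightarrow> bool" where
  "admissible_velocity_data \<tau> g \<longleftrightarrow>
     (\<forall>i. abs_cont_on (- \<tau> 0) 0 (g i) \<and>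
          (\<lambda>\<sigma>. (norm (vector_derivative (g i) (at \<sigma>)))\<^sup>2) integrable_on {- \<tau> 0..0})"

definition delayed_CS_solution ::
    "real \<Rightarrow> (real \<Rightarrow> real) \<Rightarrow> (real \<Rightarrow> real) \<Rightarrow> ('n::finite \<Rightarrow> real \<Rightarrow> real ^ 'd) \<Rightarrow>
     ('n \<Rightarrow> real \<Rightarrow> real ^ 'd) \<Rightarrow> ('n \<Rightarrow> real \<Rightarrow> real ^ 'd) \<Rightarrow> ('n \<Rightarrow> real \<Rightarrow> real ^ 'd) \<Rightarrow> bool" where
  "delayed_CS_solution lam \<psi> \<tau> f g x v \<longleftrightarrow>
     (\<forall>i. \<forall>t\<in>{- \<tau> 0..0}. x i t = f i t \<and> v i t = g i t) \<and>
     (\<forall>i. continuous_on {0..} (x i) \<and> continuous_on {0..} (v i)) \<and>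
     (\<forall>i. \<forall>t>0. (x i has_vector_derivative v i t) (at t)) \<and>
     (\<forall>i. \<forall>t>0. (v i has_vector_derivative
        (lam / real CARD('n)) *\<^sub>R
          (\<Sum>j\<in>UNIV - {i}. weight \<psi> x i j (t - \<tau> t) *\<^sub>R (v j (t - \<tau> t) - v i t))) (at t))"

definition velocity_variance :: "('n::finite \<Rightarrow> real \<Rightarrow> real ^ 'd) \<Rightarrow> real \<Rightarrow> real" where
  "velocity_variance v t =
     1 / (2 * (real CARD('n))\<^sup>2) * (\<Sum>i\<in>UNIV. \<Sum>j\<in>UNIV. (norm (v i t - v j t))\<^sup>2)"

definition laplacian ::
    "real \<Rightarrow> (real \<Rightarrow> real) \<Rightarrow> ('n::finite \<Rightarrow> real \<Rightarrow> real ^ 'd) \<Rightarrow> real \<Rightarrow> real ^ 'n ^ 'n" where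
  "laplacian lam \<psi> x t =
     (\<chi> i j. if i = j then lam / real CARD('n) * (\<Sum>k\<in>UNIV - {i}. weight \<psi> x i k t)
             else - (lam / real CARD('n)) * weight \<psi> x i j t)"

definition is_eigenvalue :: "real ^ 'n ^ 'n \<Rightarrow> real \<Rightarrow> bool" where
  "is_eigenvalue A k \<longleftrightarrow> (\<exists>u. u \<noteq> 0 \<and> A *v u = k *\<^sub>R u)"

text \<open>
  A relation rather than a function, because a matrix need not have a positive eigenvalue:
  \<open>is_fiedler_number A m\<close> includes that one exists.
\<close>

definition is_fiedler_number :: "real ^ 'n ^ 'n \<Rightarrow> real \<Rightarrow> bool" where
  "is_fiedler_number A m \<longleftrightarrow>
     is_eigenvalue A m \<and> 0 < m \<and> (\<forall>k. is_eigenvalue A k \<and> 0 < k \<longrightarrow> m \<le> k)"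

definition critical_delay :: "real \<Rightarrow> real \<Rightarrow> real \<Rightarrow> real" where
  "critical_delay lam \<gamma> c = \<gamma>\<^sup>2 / (2 * lam\<^sup>2) * ((1 - c) / (2 * lam\<^sup>2 + \<gamma>\<^sup>2))"

definition decay_rate :: "real \<Rightarrow> real \<Rightarrow> real \<Rightarrow> real \<Rightarrow> real" where
  "decay_rate lam \<gamma> c \<tau>bar =
     min (\<gamma> - 4 * (lam\<^sup>2 / \<gamma>) *
            (lam\<^sup>2 * \<tau>bar\<^sup>2 / ((1 - c) * exp (- \<tau>bar) - 2 * lam\<^sup>2 * \<tau>bar\<^sup>2))) 1"

definition decay_constant ::
    "real \<Rightarrow> real \<Rightarrow> real \<Rightarrow> real \<Rightarrow> (real \<Rightarrow> real) \<Rightarrow> ('n::finite \<Rightarrow> real \<Rightarrow> real ^ 'd) \<Rightarrow> real" where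
  "decay_constant lam \<gamma> c \<tau>bar \<tau> v =
     velocity_variance v 0 +
     lam\<^sup>2 * \<tau>bar / (\<gamma> * real CARD('n)) *
       (1 / ((1 - c) * exp (- \<tau>bar) - 2 * lam\<^sup>2 * \<tau>bar\<^sup>2)) *
       integral {- \<tau> 0..0}
         (\<lambda>s. exp s * integral {s..0}
            (\<lambda>\<sigma>. \<Sum>i\<in>UNIV. (norm (vector_derivative (v i) (at \<sigma>)))\<^sup>2))"

end

theory Submission
  imports Defs
begin

text \<open>
  Write \<open>z\<^sub>j = v\<^sub>j (t - \<tau> t)\<close> for the delayed velocities, \<open>N\<close> for the number of agents and split
  \<open>z\<^sub>j - v\<^sub>i = (v\<^sub>j - v\<^sub>i) + (z\<^sub>j - v\<^sub>j)\<close>.  The first part makes the velocities diffuse along the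
  Laplacian at time \<open>t - \<tau> t\<close>, whose spectral gap (\<open>laplacian_spectral_gap\<close>) dissipates the variance
  \<open>V\<close> at rate \<open>2 \<gamma>\<close>.  The second part is a memory error; half of the dissipation pays for it, which
  leaves \<open>V' \<le> - \<gamma> V + lam\<^sup>2 \<tau>bar / (\<gamma> N) I\<close>, where \<open>I t\<close> is the integral of \<open>D = \<Sum>\<^sub>i |v\<^sub>i'|\<^sup>2\<close> over the window
  \<open>{t - \<tau> t..t}\<close>.  By the equation of motion, also \<open>D \<le> 4 N lam\<^sup>2 V + 2 lam\<^sup>2 \<tau>bar I\<close>.

  The integral \<open>I\<close> is controlled by adding to \<open>V\<close> a multiple \<open>\<beta>\<close> of the memory functional \<open>G\<close>, where \<open>G t\<close> is the
  integral of \<open>exp (s - t) * integral {s..t} D\<close> over \<open>s\<close> in the window.  When \<open>G\<close> is differentiated, the moving lower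
  endpoint contributes at most \<open>- (1 - c) exp (- \<tau>bar) I\<close>, the exponential \<open>- G\<close>, and the upper endpoint of the
  inner integral at most \<open>\<tau>bar D t\<close>, which the bound above
  turns back into \<open>V\<close> and \<open>I\<close>.  The weight \<open>\<beta>\<close> is the one for which all terms in \<open>I\<close> cancel; then
  \<open>F = V + \<beta> G\<close> satisfies \<open>F' \<le> - r F\<close>, the rate \<open>r\<close> being the smaller of the coefficients left at
  \<open>V\<close> and at \<open>\<beta> G\<close>, and \<open>F 0\<close> is the constant of the estimate.

  The weights may be arbitrary on the initial interval, so \<open>v\<^sub>i'\<close> can be discontinuous, and
  \<open>\<tau>\<close> is merely Lipschitz: \<open>F\<close> need not be differentiable.  The differential inequality is
  therefore read in terms of right majorants.  At each \<open>t > 0\<close>, \<open>h \<mapsto> F (t + h)\<close> lies below a function with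
  a right derivative at \<open>0\<close> that agrees with it there (\<open>lyapunov_majorant\<close>): \<open>G\<close> only grows when \<open>D\<close>
  is replaced after time \<open>t\<close> by its continuous upper bound and the endpoint \<open>t + h - \<tau> (t + h)\<close> by the smaller
  \<open>t - \<tau> t + (1 - c) h\<close>.  Such majorants suffice for a Gronwall estimate (\<open>gronwall_majorant\<close>).
\<close>

section \<open>Pairwise differences and symmetric weights\<close>

lemma sum_antisymmetric_eq_0:
  fixes a :: "'n::finite \<Rightarrow> 'n \<Rightarrow> 'a::real_vector"
  assumes "\<And>i j. a i j = - a j i"
  shows "(\<Sum>i\<in>UNIV. \<Sum>j\<in>UNIV. a i j) = 0"
proof -
  have "(\<Sum>i\<in>UNIV. \<Sum>j\<in>UNIV. a i j) = (\<Sum>i\<in>UNIV. \<Sum>j\<in>UNIV. - a j i)"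
    by (subst assms) simp
  also have "\<dots> = - (\<Sum>i\<in>UNIV. \<Sum>j\<in>UNIV. a i j)"
    by (subst sum.swap) (simp add: sum_negf)
  finally show ?thesis
    by (metis add.right_inverse add_eq_0_iff scaleR_2 scaleR_eq_0_iff zero_neq_numeral)
qed

text \<open>
  Symmetrizing in \<open>i\<close> and \<open>j\<close> is summation by parts on a weighted graph: both the dissipation of the
  variance and the quadratic form of the Laplacian come from this identity.
\<close>

lemma sum_symmetric_weights_inner:
  fixes p :: "'n::finite \<Rightarrow> 'n \<Rightarrow> real" and u w :: "'n \<Rightarrow> 'a::real_inner"
  assumes "\<And>i j. p i j = p j i"
  shows "(\<Sum>i\<in>UNIV. u i \<bullet> (\<Sum>j\<in>UNIV. p i j *\<^sub>R (w i - w j)))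
       = (\<Sum>i\<in>UNIV. \<Sum>j\<in>UNIV. p i j * ((u i - u j) \<bullet> (w i - w j))) / 2"
proof -
  have "(\<Sum>i\<in>UNIV. \<Sum>j\<in>UNIV. 2 * (u i \<bullet> (p i j *\<^sub>R (w i - w j))) - p i j * ((u i - u j) \<bullet> (w i - w j))) = 0"
  proof (rule sum_antisymmetric_eq_0)
    show "2 * (u i \<bullet> (p i j *\<^sub>R (w i - w j))) - p i j * ((u i - u j) \<bullet> (w i - w j))
        = - (2 * (u j \<bullet> (p j i *\<^sub>R (w j - w i))) - p j i * ((u j - u i) \<bullet> (w j - w i)))" for i j
      unfolding assms[of j i] by (simp add: inner_simps algebra_simps)
  qed
  then show ?thesis
    by (simp add: sum_subtractf inner_sum_right sum_distrib_left[symmetric])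
qed

definition mean :: "('n::finite \<Rightarrow> 'a::real_vector) \<Rightarrow> 'a" where
  "mean u = (\<Sum>i\<in>UNIV. u i) /\<^sub>R real CARD('n)"

text \<open>
  For weights equal to \<open>1\<close> the graph Laplacian is \<open>N\<close> times the projection onto the fluctuations around
  the mean.
\<close>

lemma sum_pairwise_inner:
  fixes u w :: "'n::finite \<Rightarrow> 'a::real_inner"
  shows "(\<Sum>i\<in>UNIV. \<Sum>j\<in>UNIV. (u i - u j) \<bullet> (w i - w j))
       = 2 * real CARD('n) * (\<Sum>i\<in>UNIV. (u i - mean u) \<bullet> w i)"
proof -
  have "(\<Sum>j\<in>UNIV. u i - u j) = real CARD('n) *\<^sub>R (u i - mean u)" for i
    by (simp add: sum_subtractf sum_constant_scaleR mean_def scaleR_diff_right)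
  then have "(\<Sum>i\<in>UNIV. w i \<bullet> (\<Sum>j\<in>UNIV. 1 *\<^sub>R (u i - u j)))
      = real CARD('n) * (\<Sum>i\<in>UNIV. (u i - mean u) \<bullet> w i)"
    by (simp add: sum_distrib_left inner_commute)
  moreover have "(\<Sum>i\<in>UNIV. w i \<bullet> (\<Sum>j\<in>UNIV. 1 *\<^sub>R (u i - u j)))
      = (\<Sum>i\<in>UNIV. \<Sum>j\<in>UNIV. 1 * ((w i - w j) \<bullet> (u i - u j))) / 2"
    by (rule sum_symmetric_weights_inner) simp
  ultimately show ?thesis by (simp add: inner_commute)
qed

lemma sum_pairwise_norm_sq:
  fixes u :: "'n::finite \<Rightarrow> 'a::real_inner"
  shows "(\<Sum>i\<in>UNIV. \<Sum>j\<in>UNIV. (norm (u i - u j))\<^sup>2)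
       = 2 * real CARD('n) * (\<Sum>i\<in>UNIV. (norm (u i - mean u))\<^sup>2)"
  using sum_pairwise_inner[of u "\<lambda>i. u i - mean u"] by (simp add: power2_norm_eq_inner)





lemma norm_sum_sq_le:
  fixes y :: "'b \<Rightarrow> 'a::real_normed_vector"
  shows "(norm (\<Sum>j\<in>S. y j))\<^sup>2 \<le> real (card S) * (\<Sum>j\<in>S. (norm (y j))\<^sup>2)"
proof -
  have "(norm (\<Sum>j\<in>S. y j))\<^sup>2 \<le> (\<Sum>j\<in>S. norm (y j))\<^sup>2"
    by (intro power_mono norm_sum) simp
  also have "\<dots> \<le> real (card S) * (\<Sum>j\<in>S. (norm (y j))\<^sup>2)"
    using sum_squared_le_sum_of_squares[of "\<lambda>j. norm (y j)" S] by (simp add: mult.commute)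
  finally show ?thesis .
qed

section \<open>The spectral gap of the weighted Laplacian\<close>

lemma laplacian_mult_component:
  fixes u :: "real ^ 'n::finite"
  shows "(laplacian lam \<psi> x t *v u) $ i
       = lam / real CARD('n) * (\<Sum>k\<in>UNIV. weight \<psi> x i k t * (u $ i - u $ k))"
proof -
  have "(laplacian lam \<psi> x t *v u) $ i = 
     laplacian lam \<psi> x t $ i $ i * u $ i + (\<Sum>k\<in>UNIV - {i}. laplacian lam \<psi> x t $ i $ k * u $ k)"
    by (simp add: matrix_vector_mult_def sum.remove[of UNIV i])
  also have "\<dots> = lam / real CARD('n) * (\<Sum>k\<in>UNIV - {i}. weight \<psi> x i k t * (u $ i - u $ k))"
    by (simp add: laplacian_def sum_distrib_left sum_distrib_right sum_subtractf[symmetric] sum.distrib[symmetric] algebra_simps)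
  also have "(\<Sum>k\<in>UNIV - {i}. weight \<psi> x i k t * (u $ i - u $ k)) = (\<Sum>k\<in>UNIV. weight \<psi> x i k t * (u $ i - u $ k))"
    by (intro sum.mono_neutral_left) auto
  finally show ?thesis .
qed

lemma weight_sym: "weight \<psi> x i j t = weight \<psi> x j i t"
  by (simp add: weight_def norm_minus_commute)

lemma laplacian_inner:
  fixes u w :: "real ^ 'n::finite"
  shows "u \<bullet> (laplacian lam \<psi> x t *v w)
       = lam / (2 * real CARD('n)) * (\<Sum>i\<in>UNIV. \<Sum>j\<in>UNIV. weight \<psi> x i j t * ((u $ i - u $ j) * (w $ i - w $ j)))"
  using sum_symmetric_weights_inner[of "\<lambda>i j. weight \<psi> x i j t" "\<lambda>i. u $ i" "\<lambda>i. w $ i", OF weight_sym]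
  by (simp add: inner_vec_def laplacian_mult_component mult.left_commute[of _ "lam / _"] sum_distrib_left[symmetric]
      del: times_divide_eq_left times_divide_eq_right) (simp add: field_simps)

text \<open>
  The minimum of the Rayleigh quotient on the unit sphere of an invariant subspace \<open>W\<close> is
  attained by compactness, and the first variation at a minimizer \<open>e\<close> in the direction of the residual \<open>z\<close>
  forces \<open>z = 0\<close>, so the minimum is an eigenvalue.  The residual is an admissible direction because \<open>A\<close> maps \<open>W\<close>
  to itself.
\<close>

lemma symmetric_rayleigh_quotient_ge_eigenvalue:
  fixes A :: "real ^ 'n ^ 'n" and W :: "(real ^ 'n) set"
  assumes sym: "\<And>u w. u \<bullet> (A *v w) = w \<bullet> (A *v u)" and W: "subspace W"
    and inv: "\<And>u. u \<in> W \<Longrightarrow> A *v u \<in> W" and "u \<in> W" "u \<noteq> 0"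
  shows "\<exists>m e. e \<in> W \<and> e \<noteq> 0 \<and> A *v e = m *\<^sub>R e \<and> (\<forall>w\<in>W. m * (norm w)\<^sup>2 \<le> w \<bullet> (A *v w))"
proof -
  define S where "S = W \<inter> sphere 0 1"
  have "compact S" unfolding S_def by (intro closed_Int_compact closed_subspace W) auto
  moreover have "u /\<^sub>R norm u \<in> S" using assms by (simp add: S_def subspace_scale)
  moreover have "continuous_on S (\<lambda>w. w \<bullet> (A *v w))"
    by (intro continuous_intros matrix_vector_mult_linear_continuous_on)
  ultimately obtain e where e: "e \<in> S" and min: "\<And>w. w \<in> S \<Longrightarrow> e \<bullet> (A *v e) \<le> w \<bullet> (A *v w)"
    using continuous_attains_inf[of S "\<lambda>w. w \<bullet> (A *v w)"] by blast
  define m where "m = e \<bullet> (A *v e)"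
  have eW: "e \<in> W" and ee: "e \<bullet> e = 1" using e by (auto simp: S_def norm_eq_1)
  have ray: "m * (norm w)\<^sup>2 \<le> w \<bullet> (A *v w)" if "w \<in> W" for w
  proof (cases "w = 0")
    case False
    have "w /\<^sub>R norm w \<in> S" using False that W by (simp add: S_def subspace_scale)
    from min[OF this] False show ?thesis
      by (simp add: m_def matrix_vector_mult_scaleR field_simps power2_eq_square)
  qed simp
  \<comment> \<open>The residual of the eigenvalue equation; it is the gradient of the Rayleigh quotient at \<open>e\<close>, up to a factor.\<close>
  define z where "z = A *v e - m *\<^sub>R e"
  have zW: "z \<in> W" unfolding z_def using W inv eW by (intro subspace_diff subspace_scale)
  define q where "q = z \<bullet> (A *v z) - m * (norm z)\<^sup>2"
  have var: "0 \<le> 2 * s * (norm z)\<^sup>2 + s\<^sup>2 * q" for s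
  proof -
    have "e + s *\<^sub>R z \<in> W" using W eW zW by (intro subspace_add subspace_scale)
    from ray[OF this] 
    have "m * ((e + s *\<^sub>R z) \<bullet> (e + s *\<^sub>R z)) \<le> (e + s *\<^sub>R z) \<bullet> (A *v (e + s *\<^sub>R z))"
      by (simp add: power2_norm_eq_inner)
    moreover have "(e + s *\<^sub>R z) \<bullet> (A *v (e + s *\<^sub>R z)) = m + 2 * s * (z \<bullet> (A *v e)) + s\<^sup>2 * (z \<bullet> (A *v z))"
      using sym[of e z] by (simp add: matrix_vector_right_distrib matrix_vector_mult_scaleR inner_simps m_def[symmetric] power2_eq_square algebra_simps)
    moreover have "(e + s *\<^sub>R z) \<bullet> (e + s *\<^sub>R z) = 1 + 2 * s * (z \<bullet> e) + s\<^sup>2 * (norm z)\<^sup>2"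
      unfolding power2_norm_eq_inner using ee by (simp add: inner_simps inner_commute[of e z] power2_eq_square algebra_simps)
    moreover have "(norm z)\<^sup>2 = z \<bullet> (A *v e) - m * (z \<bullet> e)"
      unfolding power2_norm_eq_inner by (subst (2) z_def) (simp add: inner_simps)
    ultimately have "m * (1 + 2 * s * (z \<bullet> e) + s\<^sup>2 * (norm z)\<^sup>2) \<le> m + 2 * s * (z \<bullet> (A *v e)) + s\<^sup>2 * (z \<bullet> (A *v z))"
      and e: "z \<bullet> (A *v e) = (norm z)\<^sup>2 + m * (z \<bullet> e)" by simp_all
    from this(1) show ?thesis unfolding e by (simp add: q_def algebra_simps)
  qed
  have "z = 0"
  proof (rule ccontr)
    assume "z \<noteq> 0"
    then have n: "0 < (norm z)\<^sup>2" by simp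
    \<comment> \<open>A step \<open>s\<close> along \<open>z\<close> so small that the linear term beats the quadratic one.\<close>
    define k s where "k = \<bar>q\<bar> + 1" and "s = - ((norm z)\<^sup>2 / k)"
    have k: "0 < k" "q / k < 1" by (simp_all add: k_def field_simps)
    then have "s < 0" using n by (simp add: s_def)
    moreover have "0 < 2 * (norm z)\<^sup>2 - (norm z)\<^sup>2 * (q / k)"
      using n mult_strict_left_mono[OF k(2) n] by linarith
    then have "0 < 2 * (norm z)\<^sup>2 + s * q" by (simp add: s_def)
    ultimately have "s * (2 * (norm z)\<^sup>2 + s * q) < 0" by (rule mult_neg_pos)
    also have "s * (2 * (norm z)\<^sup>2 + s * q) = 2 * s * (norm z)\<^sup>2 + s\<^sup>2 * q"
      by (simp add: power2_eq_square algebra_simps)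
    finally show False using var[of s] by simp
  qed
  then have "A *v e = m *\<^sub>R e" by (simp add: z_def)
  then show ?thesis using eW ee ray by (intro exI[of _ m] exI[of _ e]) auto
qed

text \<open>
  On the orthogonal complement of the constant vectors, the minimal Rayleigh quotient \<open>m\<close> of the Laplacian
  is an eigenvalue, and it is positive because a nonconstant vector has two different entries, joined by a
  positive weight.  Hence \<open>m\<close> is at least the Fiedler number.
\<close>

lemma laplacian_spectral_gap_scalar:
  fixes x :: "'n::finite \<Rightarrow> real \<Rightarrow> real ^ 'd" and u :: "'n \<Rightarrow> real"
  assumes lam: "0 < lam" and pos: "\<And>i j. 0 < weight \<psi> x i j t"
    and fiedler: "is_fiedler_number (laplacian lam \<psi> x t) \<mu>" and "\<gamma> \<le> \<mu>"
  shows "\<gamma> * (\<Sum>i\<in>UNIV. \<Sum>j\<in>UNIV. (u i - u j)\<^sup>2)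
       \<le> lam * (\<Sum>i\<in>UNIV. \<Sum>j\<in>UNIV. weight \<psi> x i j t * (u i - u j)\<^sup>2)"
proof -
  let ?L = "laplacian lam \<psi> x t" and ?N = "real CARD('n)"
  define W where "W = {w :: real ^ 'n. w \<bullet> 1 = 0}"
  define w where "w = (\<chi> i. u i - mean u)"
  have wdiff: "w $ i - w $ j = u i - u j" for i j by (simp add: w_def)
  have sym: "a \<bullet> (?L *v b) = b \<bullet> (?L *v a)" for a b by (simp add: laplacian_inner mult.commute)
  have W: "subspace W" by (simp add: W_def subspace_hyperplane2 inner_commute)
  have wW: "w \<in> W" by (simp add: W_def w_def mean_def inner_vec_def sum_subtractf)
  have inv: "?L *v a \<in> W" for a by (simp add: W_def inner_commute[of _ 1] laplacian_inner)
  have energy: "w \<bullet> (?L *v w) = lam / (2 * ?N) * (\<Sum>i\<in>UNIV. \<Sum>j\<in>UNIV. weight \<psi> x i j t * (u i - u j)\<^sup>2)"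
    by (simp add: laplacian_inner wdiff power2_eq_square)
  have sq: "(\<Sum>i\<in>UNIV. \<Sum>j\<in>UNIV. (u i - u j)\<^sup>2) = 2 * ?N * (norm w)\<^sup>2"
    using sum_pairwise_norm_sq[of u] unfolding power2_norm_eq_inner[of w] by (simp add: w_def inner_vec_def power2_eq_square)
  have "\<gamma> * (norm w)\<^sup>2 \<le> w \<bullet> (?L *v w)"
  proof (cases "w = 0")
    case False
    from symmetric_rayleigh_quotient_ge_eigenvalue[OF sym W inv wW False] obtain m e
      where e: "e \<in> W" "e \<noteq> 0" "?L *v e = m *\<^sub>R e" and ray: "m * (norm w)\<^sup>2 \<le> w \<bullet> (?L *v w)"
      using wW by blast
    have "\<exists>i j. e $ i \<noteq> e $ j"
    proof (rule ccontr)
      assume "\<not> ?thesis"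
      then have "e $ i = e $ undefined" for i by blast
      then obtain k where k: "\<And>i. e $ i = k" by metis
      with e(1) have "?N * k = 0" by (simp add: W_def inner_vec_def)
      then have "e = 0" using k by (simp add: vec_eq_iff)
      then show False using e(2) by simp
    qed
    then obtain a b where ab: "e $ a \<noteq> e $ b" by blast
    have nn: "0 \<le> weight \<psi> x i j t * ((e $ i - e $ j) * (e $ i - e $ j))" for i j
      by (rule mult_nonneg_nonneg[OF less_imp_le[OF pos] zero_le_square])
    have "0 < (e $ a - e $ b) * (e $ a - e $ b)" using ab by (auto simp: zero_less_mult_iff)
    then have "0 < weight \<psi> x a b t * ((e $ a - e $ b) * (e $ a - e $ b))" by (rule mult_pos_pos[OF pos])
    then have "0 < (\<Sum>j\<in>UNIV. weight \<psi> x a j t * ((e $ a - e $ j) * (e $ a - e $ j)))"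
      by (rule sum_pos2[OF finite UNIV_I _ nn])
    then have "0 < (\<Sum>i\<in>UNIV. \<Sum>j\<in>UNIV. weight \<psi> x i j t * ((e $ i - e $ j) * (e $ i - e $ j)))"
      by (rule sum_pos2[OF finite UNIV_I _ sum_nonneg[OF nn]])
    then have "0 < e \<bullet> (?L *v e)" using lam by (simp add: laplacian_inner)
    then have "0 < m * (e \<bullet> e)" using e by simp
    then have "0 < m" by (rule zero_less_mult_pos2) (use e in simp)
    then have "\<mu> \<le> m" using fiedler e by (auto simp: is_fiedler_number_def is_eigenvalue_def)
    then have "\<gamma> * (norm w)\<^sup>2 \<le> m * (norm w)\<^sup>2" using assms by (intro mult_right_mono) auto
    then show ?thesis using ray by simp
  qed simp
  then show ?thesis by (simp add: sq energy field_simps)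
qed

text \<open>
  The form in which the structural condition enters the decay estimate; it follows from the scalar case
  by summing over the coordinates.
\<close>

lemma laplacian_spectral_gap:
  fixes x :: "'n::finite \<Rightarrow> real \<Rightarrow> real ^ 'd" and w :: "'n \<Rightarrow> 'a::euclidean_space"
  assumes lam: "0 < lam" and pos: "\<And>i j. 0 < weight \<psi> x i j t"
    and fiedler: "is_fiedler_number (laplacian lam \<psi> x t) \<mu>" and "\<gamma> \<le> \<mu>"
  shows "\<gamma> * (\<Sum>i\<in>UNIV. \<Sum>j\<in>UNIV. (norm (w i - w j))\<^sup>2)
       \<le> lam * (\<Sum>i\<in>UNIV. \<Sum>j\<in>UNIV. weight \<psi> x i j t * (norm (w i - w j))\<^sup>2)"
proof -
  have nrm: "(norm (w i - w j))\<^sup>2 = (\<Sum>b\<in>Basis. (w i \<bullet> b - w j \<bullet> b)\<^sup>2)" for i j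
    unfolding power2_norm_eq_inner 
    by (subst euclidean_inner) (simp add: inner_diff_left power2_eq_square)
  have swap: "(\<Sum>i\<in>UNIV. \<Sum>j\<in>UNIV. p i j * (norm (w i - w j))\<^sup>2)
     = (\<Sum>b\<in>Basis. \<Sum>i\<in>UNIV. \<Sum>j\<in>UNIV. p i j * (w i \<bullet> b - w j \<bullet> b)\<^sup>2)" for p :: "'n \<Rightarrow> 'n \<Rightarrow> real"
    unfolding nrm sum_distrib_left
    by (subst (2) sum.swap, subst (1) sum.swap) (rule refl)
  have "\<gamma> * (\<Sum>b\<in>Basis. \<Sum>i\<in>UNIV. \<Sum>j\<in>UNIV. (w i \<bullet> b - w j \<bullet> b)\<^sup>2)
     \<le> lam * (\<Sum>b\<in>Basis. \<Sum>i\<in>UNIV. \<Sum>j\<in>UNIV. weight \<psi> x i j t * (w i \<bullet> b - w j \<bullet> b)\<^sup>2)"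
    unfolding sum_distrib_left[of \<gamma>  _ Basis] sum_distrib_left[of lam _ Basis]
    by (intro sum_mono laplacian_spectral_gap_scalar[OF assms])
  then show ?thesis using swap[of "\<lambda>_ _. 1"] swap by simp
qed

section \<open>Dissipation by the delayed force\<close>

definition delayed_force ::
    "real \<Rightarrow> ('n::finite \<Rightarrow> 'n \<Rightarrow> real) \<Rightarrow> ('n \<Rightarrow> 'a::real_vector) \<Rightarrow> ('n \<Rightarrow> 'a) \<Rightarrow> 'n \<Rightarrow> 'a" where
  "delayed_force lam p z u i = (lam / real CARD('n)) *\<^sub>R (\<Sum>j\<in>UNIV - {i}. p i j *\<^sub>R (z j - u i))"

definition memory_error ::
    "real \<Rightarrow> ('n::finite \<Rightarrow> 'n \<Rightarrow> real) \<Rightarrow> ('n \<Rightarrow> 'a::real_vector) \<Rightarrow> ('n \<Rightarrow> 'a) \<Rightarrow> 'n \<Rightarrow> 'a" where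
  "memory_error lam p z u i = (lam / real CARD('n)) *\<^sub>R (\<Sum>j\<in>UNIV - {i}. p i j *\<^sub>R (z j - u j))"

text \<open>
  Diffusion along the current velocities \<open>u\<close>, and an error that measures how far the delayed
  velocities \<open>z\<close> are from them.
\<close>

lemma delayed_force_split:
  "delayed_force lam p z u i
   = - ((lam / real CARD('n)) *\<^sub>R (\<Sum>j\<in>UNIV. p i j *\<^sub>R (u i - u j))) + memory_error lam p z u i"
  for u :: "'n::finite \<Rightarrow> 'a::real_vector"
proof -
  have "(\<Sum>j\<in>UNIV. p i j *\<^sub>R (u i - u j)) = (\<Sum>j\<in>UNIV - {i}. p i j *\<^sub>R (u i - u j))"
    by (intro sum.mono_neutral_right) auto
  moreover have "(\<Sum>j\<in>UNIV - {i}. p i j *\<^sub>R (z j - u i))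
      = - (\<Sum>j\<in>UNIV - {i}. p i j *\<^sub>R (u i - u j)) + (\<Sum>j\<in>UNIV - {i}. p i j *\<^sub>R (z j - u j))"
    unfolding sum_negf[symmetric] sum.distrib[symmetric] by (intro sum.cong refl) (simp add: algebra_simps)
  ultimately show ?thesis
    by (simp add: delayed_force_def memory_error_def scaleR_diff_right)
qed

context
  fixes lam :: real and p :: "'n::finite \<Rightarrow> 'n \<Rightarrow> real" and z u :: "'n \<Rightarrow> 'a::real_inner"
  assumes p0: "\<And>i j. 0 \<le> p i j" and p1: "\<And>i j. p i j \<le> 1"
begin

lemma sum_norm_sq_memory_error_le:
  "(\<Sum>i\<in>UNIV. (norm (memory_error lam p z u i))\<^sup>2) \<le> lam\<^sup>2 * (\<Sum>j\<in>UNIV. (norm (z j - u j))\<^sup>2)"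
proof -
  let ?N = "real CARD('n)"
  have le1: "(norm (p i j *\<^sub>R y))\<^sup>2 \<le> (norm y)\<^sup>2" for i j and y :: 'a
    by (intro power_mono) (simp_all add: p0 p1 mult_left_le_one_le)
  have "(norm (memory_error lam p z u i))\<^sup>2 \<le> lam\<^sup>2 / ?N * (\<Sum>j\<in>UNIV. (norm (z j - u j))\<^sup>2)" for i
  proof -
    have "(norm (\<Sum>j\<in>UNIV - {i}. p i j *\<^sub>R (z j - u j)))\<^sup>2
       \<le> real (card (UNIV - {i})) * (\<Sum>j\<in>UNIV - {i}. (norm (p i j *\<^sub>R (z j - u j)))\<^sup>2)" by (rule norm_sum_sq_le)
    also have "\<dots> \<le> ?N * (\<Sum>j\<in>UNIV. (norm (z j - u j))\<^sup>2)"
      by (intro mult_mono order_trans[OF sum_mono[OF le1] sum_mono2]) (auto intro: sum_nonneg simp: card_Diff_subset)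
    finally have "(lam / ?N)\<^sup>2 * (norm (\<Sum>j\<in>UNIV - {i}. p i j *\<^sub>R (z j - u j)))\<^sup>2
       \<le> (lam / ?N)\<^sup>2 * (?N * (\<Sum>j\<in>UNIV. (norm (z j - u j))\<^sup>2))" by (intro mult_left_mono) auto
    then show ?thesis
      by (simp add: memory_error_def power_mult_distrib power_divide) (simp add: power2_eq_square)
  qed
  then have "(\<Sum>i\<in>UNIV. (norm (memory_error lam p z u i))\<^sup>2)
     \<le> (\<Sum>i\<in>(UNIV :: 'n set). lam\<^sup>2 / ?N * (\<Sum>j\<in>UNIV. (norm (z j - u j))\<^sup>2))" by (intro sum_mono)
  then show ?thesis by simp
qed

text \<open>
  Feeds the squared accelerations, of which the memory functional is made, back into the variance and
  the displacement over one delay.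
\<close>

lemma sum_norm_sq_delayed_force_le:
  "(\<Sum>i\<in>UNIV. (norm (delayed_force lam p z u i))\<^sup>2)
   \<le> 2 * lam\<^sup>2 / real CARD('n) * (\<Sum>i\<in>UNIV. \<Sum>j\<in>UNIV. (norm (u i - u j))\<^sup>2)
     + 2 * lam\<^sup>2 * (\<Sum>j\<in>UNIV. (norm (z j - u j))\<^sup>2)"
proof -
  let ?N = "real CARD('n)"
  define a where "a i = (lam / ?N) *\<^sub>R (\<Sum>j\<in>UNIV. p i j *\<^sub>R (u i - u j))" for i
  have le1: "(norm (p i j *\<^sub>R y))\<^sup>2 \<le> (norm y)\<^sup>2" for i j and y :: 'a
    by (intro power_mono) (simp_all add: p0 p1 mult_left_le_one_le)
  have a: "(norm (a i))\<^sup>2 \<le> lam\<^sup>2 / ?N * (\<Sum>j\<in>UNIV. (norm (u i - u j))\<^sup>2)" for i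
  proof -
    have "(norm (\<Sum>j\<in>UNIV. p i j *\<^sub>R (u i - u j)))\<^sup>2
       \<le> ?N * (\<Sum>j\<in>UNIV. (norm (p i j *\<^sub>R (u i - u j)))\<^sup>2)" by (rule norm_sum_sq_le)
    also have "\<dots> \<le> ?N * (\<Sum>j\<in>UNIV. (norm (u i - u j))\<^sup>2)"
      by (intro mult_left_mono sum_mono le1) auto
    finally have "(lam / ?N)\<^sup>2 * (norm (\<Sum>j\<in>UNIV. p i j *\<^sub>R (u i - u j)))\<^sup>2
       \<le> (lam / ?N)\<^sup>2 * (?N * (\<Sum>j\<in>UNIV. (norm (u i - u j))\<^sup>2))" by (intro mult_left_mono) auto
    then show ?thesis
      by (simp add: a_def power_mult_distrib power_divide) (simp add: power2_eq_square)
  qed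
  have "(\<Sum>i\<in>UNIV. (norm (delayed_force lam p z u i))\<^sup>2)
     \<le> (\<Sum>i\<in>UNIV. 2 * (norm (a i))\<^sup>2 + 2 * (norm (memory_error lam p z u i))\<^sup>2)"
  proof (rule sum_mono)
    fix i
    let ?R = "memory_error lam p z u i"
    have "0 \<le> (norm (a i + ?R))\<^sup>2" by simp
    then show "(norm (delayed_force lam p z u i))\<^sup>2 \<le> 2 * (norm (a i))\<^sup>2 + 2 * (norm ?R)\<^sup>2"
      unfolding delayed_force_split a_def[symmetric] power2_norm_eq_inner by (simp add: inner_simps inner_commute[of ?R "a i"])
  qed
  also have "\<dots> = 2 * (\<Sum>i\<in>UNIV. (norm (a i))\<^sup>2) + 2 * (\<Sum>i\<in>UNIV. (norm (memory_error lam p z u i))\<^sup>2)"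
    by (simp add: sum.distrib sum_distrib_left)
  also have "\<dots> \<le> 2 * (\<Sum>i\<in>UNIV. lam\<^sup>2 / ?N * (\<Sum>j\<in>UNIV. (norm (u i - u j))\<^sup>2))
      + 2 * (lam\<^sup>2 * (\<Sum>j\<in>UNIV. (norm (z j - u j))\<^sup>2))"
    by (intro add_mono mult_left_mono sum_mono a sum_norm_sq_memory_error_le) auto
  finally show ?thesis by (simp add: sum_distrib_left mult.assoc)
qed

text \<open>
  The diffusive part dissipates at rate \<open>2 \<gamma>\<close> by the spectral gap; Young's inequality with parameter \<open>\<gamma>\<close>
  spends half of this on the memory error.  The right factor \<open>1 / N\<close> in the error term depends on pairing
  the error with the fluctuation \<open>u\<^sub>i - mean u\<close> instead of with the differences \<open>u\<^sub>i - u\<^sub>j\<close>.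
\<close>

lemma inner_fluctuation_delayed_force_le:
  assumes sym: "\<And>i j. p i j = p j i" and "0 < \<gamma>"
    and gap: "\<gamma> * (\<Sum>i\<in>UNIV. \<Sum>j\<in>UNIV. (norm (u i - u j))\<^sup>2)
       \<le> lam * (\<Sum>i\<in>UNIV. \<Sum>j\<in>UNIV. p i j * (norm (u i - u j))\<^sup>2)"
  shows "2 * (\<Sum>i\<in>UNIV. (u i - mean u) \<bullet> delayed_force lam p z u i)
     \<le> - \<gamma> * (\<Sum>i\<in>UNIV. (norm (u i - mean u))\<^sup>2) + lam\<^sup>2 / \<gamma> * (\<Sum>j\<in>UNIV. (norm (z j - u j))\<^sup>2)"
proof -
  let ?N = "real CARD('n)"
  define w where "w i = u i - mean u" for i
  define S where "S = (\<Sum>i\<in>UNIV. (norm (w i))\<^sup>2)"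
  define a where "a i = (\<Sum>j\<in>UNIV. p i j *\<^sub>R (u i - u j))" for i
  have wdiff: "w i - w j = u i - u j" for i j by (simp add: w_def)
  have "(\<Sum>i\<in>UNIV. w i \<bullet> a i) = (\<Sum>i\<in>UNIV. \<Sum>j\<in>UNIV. p i j * (norm (u i - u j))\<^sup>2) / 2"
    using sum_symmetric_weights_inner[of p w u, OF sym] by (simp add: wdiff power2_norm_eq_inner a_def)
  then have energy: "(\<Sum>i\<in>UNIV. \<Sum>j\<in>UNIV. p i j * (norm (u i - u j))\<^sup>2) = 2 * (\<Sum>i\<in>UNIV. w i \<bullet> a i)"
    by simp
  have "\<gamma> * (2 * ?N * S) \<le> lam * (2 * (\<Sum>i\<in>UNIV. w i \<bullet> a i))"
    using gap unfolding sum_pairwise_norm_sq S_def energy w_def .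
  then have drift: "\<gamma> * S \<le> lam / ?N * (\<Sum>i\<in>UNIV. w i \<bullet> a i)" by (simp add: field_simps)
  have "2 * (w i \<bullet> memory_error lam p z u i) \<le> \<gamma> * (norm (w i))\<^sup>2 + (norm (memory_error lam p z u i))\<^sup>2 / \<gamma>" for i
  proof -
    let ?R = "memory_error lam p z u i"
    have "0 \<le> (norm (\<gamma> *\<^sub>R w i - ?R))\<^sup>2" by simp
    also have "\<dots> = \<gamma>\<^sup>2 * (norm (w i))\<^sup>2 - 2 * \<gamma> * (w i \<bullet> ?R) + (norm ?R)\<^sup>2"
      unfolding power2_norm_eq_inner by (simp add: inner_simps inner_commute power2_eq_square algebra_simps)
    finally have "0 \<le> (\<gamma>\<^sup>2 * (norm (w i))\<^sup>2 - 2 * \<gamma> * (w i \<bullet> ?R) + (norm ?R)\<^sup>2) / \<gamma>"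
      using \<open>0 < \<gamma>\<close> by (intro divide_nonneg_pos)
    then show ?thesis
      using \<open>0 < \<gamma>\<close> by (simp add: diff_divide_distrib add_divide_distrib power2_eq_square)
  qed
  then have "(\<Sum>i\<in>UNIV. 2 * (w i \<bullet> memory_error lam p z u i))
     \<le> (\<Sum>i\<in>UNIV. \<gamma> * (norm (w i))\<^sup>2 + (norm (memory_error lam p z u i))\<^sup>2 / \<gamma>)" by (intro sum_mono)
  then have "2 * (\<Sum>i\<in>UNIV. w i \<bullet> memory_error lam p z u i)
     \<le> \<gamma> * S + (\<Sum>i\<in>UNIV. (norm (memory_error lam p z u i))\<^sup>2) / \<gamma>"
    by (simp add: sum.distrib sum_distrib_left sum_divide_distrib S_def)
  also have "\<dots> \<le> \<gamma> * S + lam\<^sup>2 * (\<Sum>j\<in>UNIV. (norm (z j - u j))\<^sup>2) / \<gamma>"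
    using \<open>0 < \<gamma>\<close> by (intro add_left_mono divide_right_mono sum_norm_sq_memory_error_le) auto
  finally have err: "2 * (\<Sum>i\<in>UNIV. w i \<bullet> memory_error lam p z u i)
     \<le> \<gamma> * S + lam\<^sup>2 * (\<Sum>j\<in>UNIV. (norm (z j - u j))\<^sup>2) / \<gamma>" .
  have "(\<Sum>i\<in>UNIV. w i \<bullet> delayed_force lam p z u i)
     = - (lam / ?N * (\<Sum>i\<in>UNIV. w i \<bullet> a i)) + (\<Sum>i\<in>UNIV. w i \<bullet> memory_error lam p z u i)"
    by (simp add: delayed_force_split a_def[symmetric] inner_add_right inner_diff_right sum.distrib sum_subtractf sum_distrib_left)
  then show ?thesis using drift err unfolding w_def[symmetric] S_def[symmetric] by simp
qed

end

section \<open>The derivative of the velocity variance\<close>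

lemma velocity_variance_eq:
  fixes v :: "'n::finite \<Rightarrow> real \<Rightarrow> real ^ 'd"
  shows "velocity_variance v t = (\<Sum>i\<in>UNIV. (norm (v i t - mean (\<lambda>j. v j t)))\<^sup>2) / real CARD('n)"
  unfolding velocity_variance_def sum_pairwise_norm_sq[of "\<lambda>i. v i t"] by (simp add: power2_eq_square)

lemma has_real_derivative_velocity_variance:
  fixes v :: "'n::finite \<Rightarrow> real \<Rightarrow> real ^ 'd"
  assumes "\<And>i. (v i has_vector_derivative v' i) (at t within S)"
  shows "(velocity_variance v has_real_derivative
     2 / real CARD('n) * (\<Sum>i\<in>UNIV. (v i t - mean (\<lambda>j. v j t)) \<bullet> v' i)) (at t within S)"
proof -
  have square: "((\<lambda>s. d s \<bullet> d s) has_real_derivative 2 * (d t \<bullet> d')) (at t within S)"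
    if "(d has_vector_derivative d') (at t within S)" for d :: "real \<Rightarrow> real ^ 'd" and d'
    unfolding has_field_derivative_def
    by (rule has_derivative_eq_rhs[OF has_derivative_inner[OF that[unfolded has_vector_derivative_def] that[unfolded has_vector_derivative_def]]])
       (simp add: inner_commute fun_eq_iff)
  have "((\<lambda>s. (v i s - v j s) \<bullet> (v i s - v j s)) has_real_derivative 2 * ((v i t - v j t) \<bullet> (v' i - v' j))) (at t within S)" for i j
    by (intro square has_vector_derivative_diff assms)
  then have "(velocity_variance v has_real_derivative
     1 / (2 * (real CARD('n))\<^sup>2) * (\<Sum>i\<in>UNIV. \<Sum>j\<in>UNIV. 2 * ((v i t - v j t) \<bullet> (v' i - v' j)))) (at t within S)"
    unfolding velocity_variance_def power2_norm_eq_inner by (intro DERIV_cmult DERIV_sum)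
  then show ?thesis
    unfolding sum_distrib_left[symmetric] sum_pairwise_inner[of "\<lambda>i. v i t" v'] by (simp add: power2_eq_square)
qed

section \<open>Gronwall estimates from right majorants\<close>

text \<open>
  A function whose upper right Dini derivative is nonpositive does not increase.  If it exceeded a line of
  slope \<open>e > 0\<close> starting at a point \<open>s > 0\<close>, it would have to leave that line after a last time of contact, where the
  Dini derivative would be at least \<open>e\<close>.
\<close>

lemma dini_nonpos_imp_antimono:
  fixes \<phi> :: "real \<Rightarrow> real"
  assumes "0 \<le> T" and cont: "continuous_on {0..T} \<phi>"
    and dini: "\<And>t e. 0 < t \<Longrightarrow> t < T \<Longrightarrow> 0 < e \<Longrightarrow> \<forall>\<^sub>F h in at_right 0. \<phi> (t + h) \<le> \<phi> t + e * h"
  shows "\<phi> T \<le> \<phi> 0"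
proof -
  have lin: "\<phi> T \<le> \<phi> s + e * (T - s)" if "0 < s" "s \<le> T" "0 < e" for s e
  proof (rule ccontr)
    define \<eta> where "\<eta> u = \<phi> u - \<phi> s - e * (u - s)" for u
    define A where "A = {s..T} \<inter> \<eta> -` {..0}"
    assume "\<not> ?thesis"
    then have pos: "0 < \<eta> T" by (simp add: \<eta>_def)
    have "continuous_on {s..T} \<eta>" unfolding \<eta>_def
      by (intro continuous_intros continuous_on_subset[OF cont]) (use that in auto)
    then have "closed A" unfolding A_def
      by (intro continuous_closed_preimage) auto
    moreover have "s \<in> A" using that by (simp add: A_def \<eta>_def)
    moreover have bdd: "bdd_above A" unfolding A_def by (intro bdd_above_Int1) auto
    ultimately have mem: "Sup A \<in> A" using closed_contains_Sup[of A] by blast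
    \<comment> \<open>\<open>Sup A\<close> is the last time at which \<open>\<phi>\<close> does not exceed the line.\<close>
    then have lt: "Sup A < T" using pos by (cases "Sup A = T") (auto simp: A_def)
    have "0 < Sup A" using mem that by (auto simp: A_def)
    from dini[OF this lt \<open>0 < e\<close>] have "\<forall>\<^sub>F h in at_right 0. \<phi> (Sup A + h) \<le> \<phi> (Sup A) + e * h" .
    moreover have "\<forall>\<^sub>F h in at_right 0. 0 < h \<and> h < T - Sup A"
      using eventually_at_right_real[of 0 "T - Sup A"] lt by (auto elim: eventually_mono)
    ultimately have "\<forall>\<^sub>F h in at_right (0::real). False"
    proof eventually_elim
      case (elim h)
      have "\<eta> (Sup A + h) \<le> \<eta> (Sup A)" using elim by (simp add: \<eta>_def algebra_simps)
      then have "Sup A + h \<in> A" using mem elim by (auto simp: A_def)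
      then have "Sup A + h \<le> Sup A" using bdd by (rule cSup_upper)
      then show False using elim by simp
    qed
    then show False by simp
  qed
  show ?thesis
  proof (cases "T = 0")
    case False
    with assms have T: "0 < T" by simp
    \<comment> \<open>Starting point \<open>s\<close> and slope \<open>e = s\<close> tend to \<open>0\<close> together.\<close>
    have "((\<lambda>s. \<phi> s + s * (T - s)) \<longlongrightarrow> \<phi> 0 + 0 * (T - 0)) (at_right 0)"
    proof (intro tendsto_intros)
      show "(\<phi> \<longlongrightarrow> \<phi> 0) (at_right 0)"
        using continuous_on_Icc_at_rightD[OF cont T] .
    qed
    moreover have "\<forall>\<^sub>F s in at_right 0. \<phi> T \<le> \<phi> s + s * (T - s)"
    proof -
      have "\<forall>\<^sub>F s in at_right 0. 0 < s \<and> s < T"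
        using eventually_at_right_real[OF T] by (rule eventually_mono) auto
      then show ?thesis by eventually_elim (use lin in auto)
    qed
    ultimately have "\<phi> T \<le> \<phi> 0 + 0 * (T - 0)"
      by (rule tendsto_lowerbound) simp
    then show ?thesis by simp
  qed simp
qed

text \<open>
  After multiplication by \<open>exp (r t)\<close>, a right majorant of slope at most \<open>- r \<phi>\<close> becomes one of nonpositive
  slope, and a function touched from above by such majorants has nonpositive upper Dini derivatives.
\<close>

lemma gronwall_majorant:
  fixes \<phi> :: "real \<Rightarrow> real"
  assumes "0 \<le> T" and cont: "continuous_on {0..T} \<phi>"
    and maj: "\<And>t. 0 < t \<Longrightarrow> t < T \<Longrightarrow> \<exists>M m. M 0 = \<phi> t \<and> (M has_real_derivative m) (at_right 0) \<and> m \<le> - r * \<phi> t \<and>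
       (\<forall>\<^sub>F h in at_right 0. \<phi> (t + h) \<le> M h)"
  shows "\<phi> T \<le> \<phi> 0 * exp (- r * T)"
proof -
  define \<eta> where "\<eta> t = exp (r * t) * \<phi> t" for t
  have "\<eta> T \<le> \<eta> 0"
  proof (rule dini_nonpos_imp_antimono)
    show "continuous_on {0..T} \<eta>" unfolding \<eta>_def by (intro continuous_intros cont)
    fix t e :: real assume t: "0 < t" "t < T" and e: "0 < e"
    from maj[OF t] obtain M m where M: "M 0 = \<phi> t" "(M has_real_derivative m) (at_right 0)" "m \<le> - r * \<phi> t"
      "\<forall>\<^sub>F h in at_right 0. \<phi> (t + h) \<le> M h" by blast
    define K where "K h = exp (r * (t + h)) * M h" for h
    have "(K has_real_derivative exp (r * t) * (m + r * \<phi> t)) (at_right 0)"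
      unfolding K_def using M(1,2) by (auto intro!: derivative_eq_intros simp: algebra_simps)
    then have "((\<lambda>h. (K h - K 0) / (h - 0)) \<longlongrightarrow> exp (r * t) * (m + r * \<phi> t)) (at_right 0)"
      by (simp add: has_field_derivative_iff)
    moreover have "exp (r * t) * (m + r * \<phi> t) \<le> 0"
      by (rule mult_nonneg_nonpos) (use M(3) in simp_all)
    then have "exp (r * t) * (m + r * \<phi> t) < e" using e by linarith
    ultimately have "\<forall>\<^sub>F h in at_right 0. (K h - K 0) / (h - 0) < e" by (rule order_tendstoD(2))
    with M(4) eventually_at_right_less[of "0::real"]
    show "\<forall>\<^sub>F h in at_right 0. \<eta> (t + h) \<le> \<eta> t + e * h"
    proof eventually_elim
      case (elim h)
      then have "K h \<le> K 0 + e * h" by (simp add: field_simps)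
      moreover have "\<eta> (t + h) \<le> K h" using elim by (simp add: \<eta>_def K_def)
      moreover have "K 0 = \<eta> t" using M(1) by (simp add: K_def \<eta>_def)
      ultimately show ?case by linarith
    qed
  qed fact
  then show ?thesis by (simp add: \<eta>_def exp_minus field_simps)
qed

section \<open>Integrals of derivatives\<close>

text \<open>
  The integral of \<open>|w - m|\<^sup>2\<close> over the interval is nonnegative, where \<open>m\<close> is the average of \<open>w\<close>; expanding it
  gives the claim.
\<close>

lemma cauchy_schwarz_integral:
  fixes w :: "real \<Rightarrow> 'a::euclidean_space"
  assumes "a \<le> b" and w: "(w has_integral z) {a..b}" and sq: "(\<lambda>s. (norm (w s))\<^sup>2) integrable_on {a..b}"
  shows "(norm z)\<^sup>2 \<le> (b - a) * integral {a..b} (\<lambda>s. (norm (w s))\<^sup>2)"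
proof (cases "a = b")
  case True
  then have "z = 0" using has_integral_unique[OF w] has_integral_refl(2)[of w a] by (simp add: cbox_interval)
  then show ?thesis using True by simp
next
  case False
  define m where "m = z /\<^sub>R (b - a)"
  have "((\<lambda>s. (norm (w s))\<^sup>2 - 2 * (w s \<bullet> m) + (norm m)\<^sup>2) has_integral
      integral {a..b} (\<lambda>s. (norm (w s))\<^sup>2) - 2 * (z \<bullet> m) + (b - a) *\<^sub>R (norm m)\<^sup>2) {a..b}"
    using assms(1) by (intro has_integral_add has_integral_diff has_integral_mult_right integrable_integral sq has_integral_linear[OF w bounded_linear_inner_left, unfolded o_def] has_integral_const_real[THEN has_integral_eq_rhs]) auto
  moreover have "0 \<le> (norm (w s))\<^sup>2 - 2 * (w s \<bullet> m) + (norm m)\<^sup>2" for s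
    using zero_le_power2[of "norm (w s - m)"] by (simp add: power2_norm_eq_inner inner_simps inner_commute)
  ultimately have "0 \<le> integral {a..b} (\<lambda>s. (norm (w s))\<^sup>2) - 2 * (z \<bullet> m) + (b - a) *\<^sub>R (norm m)\<^sup>2"
    by (rule has_integral_nonneg)
  moreover have "z \<bullet> m = (norm z)\<^sup>2 / (b - a)" and "(norm m)\<^sup>2 = (norm z)\<^sup>2 / (b - a)\<^sup>2"
    unfolding m_def power2_norm_eq_inner by (simp_all add: divide_inverse power2_eq_square)
  ultimately have "0 \<le> integral {a..b} (\<lambda>s. (norm (w s))\<^sup>2) - (norm z)\<^sup>2 / (b - a)"
    using False by (simp add: power2_eq_square)
  then show ?thesis using False assms(1) by (simp add: field_simps)
qed

lemma abs_cont_has_integral: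
  assumes "abs_cont_on a b h" and "a \<le> s" "s \<le> t" "t \<le> b"
  shows "((\<lambda>\<sigma>. vector_derivative h (at \<sigma>)) has_integral (h t - h s)) {s..t}"
proof -
  let ?h = "\<lambda>\<sigma>. vector_derivative h (at \<sigma>)"
  have int: "?h integrable_on {a..b}" and eq: "\<And>u. u \<in> {a..b} \<Longrightarrow> h u = h a + integral {a..u} ?h"
    using assms(1) unfolding abs_cont_on_def by (blast dest: set_lebesgue_integral_eq_integral(1))+
  have "integral {a..s} ?h + integral {s..t} ?h = integral {a..t} ?h"
    using assms by (intro Henstock_Kurzweil_Integration.integral_combine integrable_subinterval_real[OF int]) auto
  moreover have "h s = h a + integral {a..s} ?h" and "h t = h a + integral {a..t} ?h"
    by (rule eq, use assms in simp)+
  ultimately have "integral {s..t} ?h = h t - h s" by (simp add: eq_diff_eq add.commute)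
  moreover have "?h integrable_on {s..t}" using assms by (intro integrable_subinterval_real[OF int]) auto
  ultimately show ?thesis by (simp add: has_integral_iff)
qed

text \<open>
  The left endpoint is excluded from the bound because \<open>w\<close> will be a derivative there, with an
  unspecified value.
\<close>

lemma integrable_norm_sq_if_bounded:
  fixes w :: "real \<Rightarrow> 'a::euclidean_space"
  assumes w: "w integrable_on {a..b}" and bound: "\<And>s. a < s \<Longrightarrow> s \<le> b \<Longrightarrow> (norm (w s))\<^sup>2 \<le> C"
  shows "(\<lambda>s. (norm (w s))\<^sup>2) integrable_on {a..b}"
proof (rule measurable_bounded_by_integrable_imp_integrable_real)
  show "(\<lambda>s. (norm (w s))\<^sup>2) \<in> borel_measurable (lebesgue_on {a..b})"
    using integrable_imp_measurable[OF w] by measurable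
  show "(\<lambda>s. if s = a then (norm (w a))\<^sup>2 else C) integrable_on {a..b}"
    by (rule integrable_spike[where f = "\<lambda>_. C" and S = "{a}"]) auto
qed (use bound in auto)

lemma continuous_on_Ici_if_Icc:
  fixes h :: "real \<Rightarrow> 'a::topological_space"
  assumes "\<And>T. continuous_on {a..T} h"
  shows "continuous_on {a..} h"
  unfolding continuous_on_eq_continuous_within
proof
  fix s assume s: "s \<in> {a..}"
  have "at s within {a..} = at s within {a..s + 1}"
    by (rule at_within_nhd[of s "{..<s + 1}"]) auto
  then show "continuous (at s within {a..}) h"
    using assms[of "s + 1"] s by (simp add: continuous_on_eq_continuous_within)
qed

lemma integral_has_real_derivative_interior:
  assumes cont: "continuous_on {a..} f" and "a < s"
  shows "((\<lambda>x. integral {a..x} f) has_real_derivative f s) (at s)"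
proof -
  have "((\<lambda>x. integral {a..x} f) has_real_derivative f s) (at s within {a..s + 1})"
    by (rule integral_has_real_derivative) (use assms in \<open>auto intro: continuous_on_subset[OF cont]\<close>)
  then show ?thesis using assms at_within_Icc_at[of a s "s + 1"] by simp
qed

section \<open>The memory functional\<close>

text \<open>
  The integral of \<open>exp (s - t) * (p - P s)\<close> over \<open>s\<close> in \<open>{l..t}\<close> (\<open>memory_eq_integral\<close>), with the variables \<open>p\<close> and \<open>t\<close> pulled out
  of the integral: in this form its dependence on \<open>p\<close>, \<open>l\<close> and \<open>t\<close> can be differentiated.  When \<open>P\<close> is a primitive of a function \<open>D\<close>
  and \<open>p = P t\<close>, the factor \<open>p - P s\<close> is the integral of \<open>D\<close> over \<open>{s..t}\<close>.
\<close>

definition memory :: "(real \<Rightarrow> real) \<Rightarrow> real \<Rightarrow> real \<Rightarrow> real \<Rightarrow> real" where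
  "memory P p l t = exp (- t) * (p * (exp t - exp l) - integral {l..t} (\<lambda>s. exp s * P s))"

lemma exp_has_integral: "a \<le> b \<Longrightarrow> (exp has_integral exp b - exp a) {a..b}" for a b :: real
  by (rule fundamental_theorem_of_calculus)
     (auto intro!: derivative_eq_intros simp flip: has_real_derivative_iff_has_vector_derivative)

lemma memory_eq_integral:
  assumes "l \<le> t" "continuous_on {l..t} P"
  shows "memory P p l t = integral {l..t} (\<lambda>s. exp (s - t) * (p - P s))"
proof -
  have "(\<lambda>s. exp s * P s) integrable_on {l..t}"
    by (intro integrable_continuous_real continuous_intros assms(2))
  then have "((\<lambda>s. exp (- t) * (p * exp s - exp s * P s)) has_integral
      exp (- t) * (p * (exp t - exp l) - integral {l..t} (\<lambda>s. exp s * P s))) {l..t}"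
    by (intro has_integral_mult_right has_integral_diff exp_has_integral assms(1) integrable_integral)
  moreover have "exp (- t) * (p * exp s - exp s * P s) = exp (s - t) * (p - P s)" for s
    by (simp add: exp_diff exp_minus field_simps)
  ultimately show ?thesis unfolding memory_def by (simp add: integral_unique)
qed

lemma memory_nonneg:
  assumes "l \<le> t" "continuous_on {l..t} P" and "\<And>s. l \<le> s \<Longrightarrow> s \<le> t \<Longrightarrow> P s \<le> p"
  shows "0 \<le> memory P p l t"
  unfolding memory_eq_integral[OF assms(1,2)]
  by (rule integral_nonneg) (use assms in \<open>auto intro!: integrable_continuous_real continuous_intros mult_nonneg_nonneg\<close>)

text \<open>
  The integrand of \<open>memory\<close> is nonnegative as long as \<open>p\<close> bounds \<open>P\<close>, so the value grows with \<open>p\<close> and when the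
  interval is extended to the left.
\<close>

lemma memory_mono:
  assumes cont: "continuous_on {l'..t} P" and le: "\<And>s. l' \<le> s \<Longrightarrow> s \<le> t \<Longrightarrow> P s \<le> p"
    and "p \<le> p'" "l' \<le> l" "l \<le> t"
  shows "memory P p l t \<le> memory P p' l' t"
proof -
  have "memory P p l t \<le> memory P p' l t"
    unfolding memory_def using assms by (intro mult_left_mono diff_right_mono mult_right_mono) auto
  also have "memory P p' l t \<le> memory P p' l' t"
  proof -
    have cont': "continuous_on {l..t} P" by (rule continuous_on_subset[OF cont]) (use assms in auto)
    have le': "l' \<le> t" using assms by simp
    show ?thesis
      unfolding memory_eq_integral[OF assms(5) cont'] memory_eq_integral[OF le' cont]
      by (rule integral_subset_le)
         (use assms cont' le in \<open>auto intro!: integrable_continuous_real continuous_intros mult_nonneg_nonneg intro: order_trans[OF le assms(3)]\<close>)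
  qed
  finally show ?thesis .
qed

text \<open>
  By \<open>memory_mono\<close>, the growing quantity \<open>P (t + h)\<close> may be replaced by a bound \<open>b h\<close>, and the lower endpoint \<open>l (t + h)\<close> by the
  linear function \<open>l t + k * h\<close>.  With these replacements the functional becomes differentiable in \<open>h\<close>, although \<open>P\<close> and \<open>l\<close> are not:
  what remains of them is the primitive of the continuous function \<open>exp s * P s\<close>, taken at smooth endpoints.  The three
  terms of the derivative come from the growth of \<open>b\<close>, the exponential kernel and the moving lower endpoint; the
  upper endpoint contributes nothing because the integrand vanishes there.
\<close>

lemma memory_majorant:
  assumes cont: "continuous_on {a..} P" and mono: "\<And>r s. a \<le> r \<Longrightarrow> r \<le> s \<Longrightarrow> P r \<le> P s"
    and l: "a < l t" "l t \<le> t" and k: "0 \<le> k"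
    and lower: "\<And>h. 0 \<le> h \<Longrightarrow> l t + k * h \<le> l (t + h) \<and> l (t + h) \<le> t + h"
    and b: "(b has_real_derivative B) (at_right 0)" "b 0 = P t" and Pb: "\<And>h. 0 \<le> h \<Longrightarrow> P (t + h) \<le> b h"
  shows "\<exists>M. M 0 = memory P (P t) (l t) t \<and>
     (M has_real_derivative (1 - exp (l t - t)) * B - memory P (P t) (l t) t
        - k * exp (l t - t) * (P t - P (l t))) (at_right 0) \<and>
     (\<forall>h\<ge>0. memory P (P (t + h)) (l (t + h)) (t + h) \<le> M h)"
proof -
  define Q where "Q s = integral {a..s} (\<lambda>s. exp s * P s)" for s
  have cexp: "continuous_on {a..} (\<lambda>s. exp s * P s)" by (intro continuous_intros cont)
  have Q: "(Q has_real_derivative exp s * P s) (at s)" if "a < s" for s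
    unfolding Q_def by (rule integral_has_real_derivative_interior[OF cexp that])
  have Qdiff: "integral {r..s} (\<lambda>s. exp s * P s) = Q s - Q r" if "a \<le> r" "r \<le> s" for r s
  proof -
    have "(\<lambda>s. exp s * P s) integrable_on {a..s}"
      by (intro integrable_continuous_real continuous_on_subset[OF cexp]) auto
    from Henstock_Kurzweil_Integration.integral_combine[OF that this] show ?thesis by (simp add: Q_def)
  qed
  define M where "M h = exp (- (t + h)) * (b h * (exp (t + h) - exp (l t + k * h)) - (Q (t + h) - Q (l t + k * h)))" for h
  have al: "a \<le> l t + k * h" if "0 \<le> h" for h using l(1) mult_nonneg_nonneg[OF k that] by linarith
  have M: "M h = memory P (b h) (l t + k * h) (t + h)" if "0 \<le> h" for h
    using Qdiff[OF al[OF that], of "t + h"] lower[OF that] unfolding M_def memory_def by simp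
  have "((\<lambda>h. Q (t + h)) has_real_derivative exp t * P t * 1) (at 0 within {0<..})"
    by (rule DERIV_chain2[where g = "\<lambda>h. t + h"]) (use Q[of t] l in \<open>auto intro!: derivative_eq_intros\<close>)
  moreover have "((\<lambda>h. Q (l t + k * h)) has_real_derivative exp (l t) * P (l t) * k) (at 0 within {0<..})"
    by (rule DERIV_chain2[where g = "\<lambda>h. l t + k * h"]) (use Q[of "l t"] l in \<open>auto intro!: derivative_eq_intros\<close>)
  ultimately have dQ: "((\<lambda>h. Q (t + h) - Q (l t + k * h)) has_real_derivative exp t * P t - exp (l t) * P (l t) * k) (at 0 within {0<..})"
    by (auto intro!: derivative_eq_intros)
  have dE: "((\<lambda>h. exp (t + h) - exp (l t + k * h)) has_real_derivative exp t - k * exp (l t)) (at 0 within {0<..})"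
    and de: "((\<lambda>h. exp (- (t + h))) has_real_derivative - exp (- t)) (at 0 within {0<..})"
    by (auto intro!: derivative_eq_intros)
  have "(M has_real_derivative
      - exp (- t) * (b 0 * (exp (t + 0) - exp (l t + k * 0)) - (Q (t + 0) - Q (l t + k * 0)))
      + (B * (exp (t + 0) - exp (l t + k * 0)) + (exp t - k * exp (l t)) * b 0
          - (exp t * P t - exp (l t) * P (l t) * k)) * exp (- (t + 0))) (at 0 within {0<..})"
    unfolding M_def by (intro DERIV_mult DERIV_diff de dE dQ b)
  moreover have "- exp (- t) * (b 0 * (exp (t + 0) - exp (l t + k * 0)) - (Q (t + 0) - Q (l t + k * 0)))
      + (B * (exp (t + 0) - exp (l t + k * 0)) + (exp t - k * exp (l t)) * b 0
          - (exp t * P t - exp (l t) * P (l t) * k)) * exp (- (t + 0))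
     = (1 - exp (l t - t)) * B - M 0 - k * exp (l t - t) * (P t - P (l t))"
    by (simp add: M_def b(2) exp_diff exp_minus field_simps)
  moreover have "M 0 = memory P (P t) (l t) t" using M[of 0] b(2) by simp
  moreover have "memory P (P (t + h)) (l (t + h)) (t + h) \<le> M h" if h: "0 \<le> h" for h
    unfolding M[OF h]
  proof (rule memory_mono)
    from al[OF h] show "continuous_on {l t + k * h..t + h} P"
      and "\<And>s. l t + k * h \<le> s \<Longrightarrow> s \<le> t + h \<Longrightarrow> P s \<le> P (t + h)"
      by (auto intro: continuous_on_subset[OF cont] mono)
  qed (use lower[OF h] Pb[OF h] in auto)
  ultimately show ?thesis by (intro exI[of _ M]) auto
qed

section \<open>Solutions of the delayed system\<close>

text \<open>
  Outside a null set \<open>Z\<close> the derivative of \<open>\<tau>\<close> is bounded by \<open>c\<close>; setting it to \<open>0\<close> on \<open>Z\<close> changes no integral and makes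
  the bound hold everywhere.
\<close>

lemma admissible_delay_lipschitz:
  assumes "admissible_delay \<tau>bar c \<tau>" and "0 \<le> c" "0 \<le> s" "s \<le> t"
  shows "\<bar>\<tau> t - \<tau> s\<bar> \<le> c * (t - s)"
proof -
  let ?d = "\<lambda>\<sigma>. vector_derivative \<tau> (at \<sigma>)"
  have ac: "abs_cont_on 0 (t + 1) \<tau>" and bound: "AE t in lebesgue. 0 < t \<longrightarrow> \<bar>deriv \<tau> t\<bar> \<le> c"
    using assms by (auto simp: admissible_delay_def)
  have diff: "AE s in lebesgue. s \<in> {0..t+1} \<longrightarrow> \<tau> differentiable (at s)"
    using ac by (simp add: abs_cont_on_def)
  have "{0::real} \<in> null_sets lebesgue" by (simp flip: negligible_iff_null_sets)
  then have zero: "AE s in lebesgue. s \<noteq> (0::real)" by (rule AE_I') auto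
  from bound diff zero have "AE s in lebesgue. s \<in> {0..t+1} \<longrightarrow> \<bar>?d s\<bar> \<le> c"
  proof eventually_elim
    case (elim s)
    show ?case
    proof
      assume s: "s \<in> {0..t+1}"
      then have "(\<tau> has_vector_derivative ?d s) (at s)" using elim by (simp add: vector_derivative_works)
      then have "deriv \<tau> s = ?d s"
        by (intro DERIV_imp_deriv) (simp add: has_real_derivative_iff_has_vector_derivative)
      then show "\<bar>?d s\<bar> \<le> c" using elim s by auto
    qed
  qed
  then obtain Z where Z: "Z \<in> null_sets lebesgue"
    and sub: "{s \<in> space lebesgue. \<not> (s \<in> {0..t+1} \<longrightarrow> \<bar>?d s\<bar> \<le> c)} \<subseteq> Z"
    unfolding eventually_ae_filter by blast
  have le: "\<bar>if s \<in> Z then 0 else ?d s\<bar> \<le> c" if "s \<in> {0..t+1}" for s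
    using sub that assms(2) by auto
  have "negligible Z" using Z by (simp add: negligible_iff_null_sets)
  then have "((\<lambda>s. if s \<in> Z then 0 else ?d s) has_integral (\<tau> t - \<tau> s)) {s..t}"
    by (rule has_integral_spike[OF _ _ abs_cont_has_integral[OF ac]]) (use assms in auto)
  then have "norm (\<tau> t - \<tau> s) \<le> c * measure lborel {s..t}"
    by (rule has_integral_bound_real[OF assms(2) finite.emptyI]) (use assms le in auto)
  then show ?thesis using assms by simp
qed

text \<open>
  The smallness of the delay enters through \<open>small_delay\<close>, the positivity of the denominator in rate and
  constant.
\<close>

locale delayed_flock =
  fixes lam \<gamma> c \<tau>bar :: real
    and \<tau> \<psi> \<mu> :: "real \<Rightarrow> real"
    and f g x v :: "'n::finite \<Rightarrow> real \<Rightarrow> real ^ 'd"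
  assumes lam_pos: "0 < lam" and c_pos: "0 < c" and c_less_1: "c < 1"
    and delay: "admissible_delay \<tau>bar c \<tau>"
    and potential: "admissible_potential \<psi>"
    and data: "admissible_velocity_data \<tau> g"
    and solution: "delayed_CS_solution lam \<psi> \<tau> f g x v"
    and weight_le_1: "\<And>i j t. - \<tau> 0 \<le> t \<Longrightarrow> weight \<psi> x i j t \<le> 1"
    and fiedler: "\<And>t. - \<tau> 0 < t \<Longrightarrow> is_fiedler_number (laplacian lam \<psi> x t) (\<mu> t)"
    and \<gamma>_pos: "0 < \<gamma>"
    and fiedler_ge: "\<And>t. - \<tau> 0 < t \<Longrightarrow> \<gamma> \<le> \<mu> t"
    and small_delay: "0 < (1 - c) * exp (- \<tau>bar) - 2 * lam\<^sup>2 * \<tau>bar\<^sup>2"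
begin

definition lag :: "real \<Rightarrow> real" where "lag t = t - \<tau> t"

lemma delay_bounds: "0 < t \<Longrightarrow> 0 \<le> \<tau> t" "0 < t \<Longrightarrow> \<tau> t \<le> \<tau>bar"
  using delay by (auto simp: admissible_delay_def)

lemma delay_lipschitz: "0 \<le> s \<Longrightarrow> s \<le> t \<Longrightarrow> \<bar>\<tau> t - \<tau> s\<bar> \<le> c * (t - s)"
  using admissible_delay_lipschitz[OF delay] c_pos by simp

lemma initial_delay_nonneg: "0 \<le> \<tau> 0"
proof (rule ccontr)
  assume neg: "\<not> 0 \<le> \<tau> 0"
  \<comment> \<open>At this time the Lipschitz bound still keeps \<open>\<tau> t\<close> at or below \<open>\<tau> 0 / 2 < 0\<close>.\<close>
  define t where "t = - \<tau> 0 / (2 * c)"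
  have "0 < t" "c * t = - \<tau> 0 / 2" using neg c_pos by (simp_all add: t_def divide_neg_pos)
  then show False using delay_lipschitz[of 0 t] delay_bounds(1)[of t] neg by simp
qed

lemma \<tau>bar_nonneg: "0 \<le> \<tau>bar"
  using delay_bounds[of 1] by simp

text \<open>
  The Lipschitz bound \<open>c < 1\<close> on the delay makes the time that the agents look back to advance at least
  at speed \<open>1 - c\<close>; in particular it never returns to \<open>- \<tau> 0\<close>.
\<close>

lemma lag_lower: "0 \<le> t \<Longrightarrow> 0 \<le> h \<Longrightarrow> lag t + (1 - c) * h \<le> lag (t + h)"
  using delay_lipschitz[of t "t + h"] by (simp add: lag_def algebra_simps)

lemma lag_0: "lag 0 = - \<tau> 0" by (simp add: lag_def)

lemma lag_gt:
  assumes "0 < t"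
  shows "- \<tau> 0 < lag t"
proof -
  have "0 < (1 - c) * t" using assms c_less_1 by simp
  then show ?thesis using lag_lower[of 0 t] assms unfolding lag_0 add_0 by linarith
qed

lemma lag_ge: "0 \<le> t \<Longrightarrow> - \<tau> 0 \<le> lag t"
  using lag_gt[of t] lag_0 by (cases "t = 0") auto

lemma lag_le: "0 \<le> t \<Longrightarrow> lag t \<le> t"
  using delay_bounds(1)[of t] initial_delay_nonneg by (cases "t = 0") (auto simp: lag_def)

lemma continuous_on_lag: "continuous_on {0..} lag"
proof -
  have "c-lipschitz_on {0..} \<tau>"
  proof (rule lipschitz_onI)
    show "dist (\<tau> s) (\<tau> t) \<le> c * dist s t" if "s \<in> {0..}" "t \<in> {0..}" for s t
      using delay_lipschitz[of s t] delay_lipschitz[of t s] that by (cases "s \<le> t") (auto simp: dist_real_def)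
  qed (use c_pos in simp)
  then show ?thesis
    unfolding lag_def by (intro continuous_intros lipschitz_on_continuous_on)
qed

lemma weight_pos: "0 < weight \<psi> x i j t"
  using potential by (simp add: admissible_potential_def weight_def)

definition acc :: "'n \<Rightarrow> real \<Rightarrow> real ^ 'd" where
  "acc i s = vector_derivative (v i) (at s)"

lemma has_vector_derivative_velocity:
  assumes "0 < t"
  shows "(v i has_vector_derivative delayed_force lam (\<lambda>i j. weight \<psi> x i j (lag t)) (\<lambda>j. v j (lag t)) (\<lambda>j. v j t) i) (at t)"
  using solution assms unfolding delayed_CS_solution_def delayed_force_def lag_def by blast

lemma acc_eq: "0 < t \<Longrightarrow> acc i t = delayed_force lam (\<lambda>i j. weight \<psi> x i j (lag t)) (\<lambda>j. v j (lag t)) (\<lambda>j. v j t) i"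
  unfolding acc_def by (rule vector_derivative_at[OF has_vector_derivative_velocity])

lemma velocity_data: "t \<in> {- \<tau> 0..0} \<Longrightarrow> v i t = g i t"
  using solution by (simp add: delayed_CS_solution_def)

text \<open>
  Only the interior of the initial interval: at its endpoints the derivative of \<open>v\<close> depends on values beyond the data.
\<close>

lemma acc_data:
  assumes "t \<in> {- \<tau> 0<..<0}"
  shows "acc i t = vector_derivative (g i) (at t)"
  unfolding acc_def
proof (rule vector_derivative_cong_eq)
  have "\<forall>\<^sub>F s in nhds t. s \<in> {- \<tau> 0<..<0}" using assms by (intro eventually_nhds_in_open) auto
  then show "\<forall>\<^sub>F s in nhds t. s \<in> UNIV \<longrightarrow> v i s = g i s"
    by eventually_elim (simp add: velocity_data)
qed auto

lemma acc_has_integral_past: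
  assumes "- \<tau> 0 \<le> s" "s \<le> t" "t \<le> 0"
  shows "(acc i has_integral (v i t - v i s)) {s..t}"
proof -
  have "((\<lambda>\<sigma>. vector_derivative (g i) (at \<sigma>)) has_integral (g i t - g i s)) {s..t}"
    using data assms by (intro abs_cont_has_integral[of "- \<tau> 0" 0]) (auto simp: admissible_velocity_data_def)
  then have "(acc i has_integral (g i t - g i s)) {s..t}"
    by (rule has_integral_spike[where S = "{- \<tau> 0, 0}", rotated 2]) (use assms in \<open>auto simp: acc_data\<close>)
  then show ?thesis using assms by (simp add: velocity_data)
qed

text \<open>
  The velocities are primitives of their derivatives across time \<open>0\<close>, where they have a kink in general: before \<open>0\<close>
  this is the absolute continuity of the data, after \<open>0\<close> it is the fundamental theorem of calculus for an
  everywhere differentiable function.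
\<close>

lemma acc_has_integral:
  assumes "- \<tau> 0 \<le> s" "s \<le> t"
  shows "(acc i has_integral (v i t - v i s)) {s..t}"
proof -
  have cont: "continuous_on {0..} (v i)" using solution by (simp add: delayed_CS_solution_def)
  have future: "(acc i has_integral (v i t - v i s)) {s..t}" if "0 \<le> s" "s \<le> t" for s t
    unfolding acc_def using that
    by (intro fundamental_theorem_of_calculus_interior continuous_on_subset[OF cont])
       (auto simp flip: vector_derivative_works intro!: differentiableI_vector has_vector_derivative_velocity)
  consider "t \<le> 0" | "0 \<le> s" | "s \<le> 0" "0 \<le> t" by linarith
  then show ?thesis
  proof cases
    case 3
    have "(acc i has_integral ((v i 0 - v i s) + (v i t - v i 0))) {s..t}"
      by (rule has_integral_combine[OF 3 acc_has_integral_past future]) (use assms 3 in auto)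
    then show ?thesis by simp
  qed (use assms acc_has_integral_past future in auto)
qed

lemma continuous_on_velocity: "continuous_on {- \<tau> 0..} (v i)"
proof -
  have "continuous_on {- \<tau> 0..T} (v i)" for T
  proof -
    have "continuous_on {- \<tau> 0..T} (\<lambda>t. v i (- \<tau> 0) + integral {- \<tau> 0..t} (acc i))"
    proof (cases "- \<tau> 0 \<le> T")
      case True
      then show ?thesis
        using acc_has_integral[of "- \<tau> 0" T i] by (intro continuous_intros indefinite_integral_continuous_1) auto
    qed simp
    then show ?thesis
      by (rule continuous_on_eq) (simp add: integral_unique[OF acc_has_integral])
  qed
  then show ?thesis by (rule continuous_on_Ici_if_Icc)
qed

lemma delayed_force_bounds:
  assumes "0 < t"
  shows "(\<Sum>i\<in>UNIV. (norm (acc i t))\<^sup>2)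
     \<le> 4 * real CARD('n) * lam\<^sup>2 * velocity_variance v t + 2 * lam\<^sup>2 * (\<Sum>j\<in>UNIV. (norm (v j (lag t) - v j t))\<^sup>2)"
    and "2 * (\<Sum>i\<in>UNIV. (v i t - mean (\<lambda>j. v j t)) \<bullet> acc i t)
     \<le> - \<gamma> * real CARD('n) * velocity_variance v t + lam\<^sup>2 / \<gamma> * (\<Sum>j\<in>UNIV. (norm (v j (lag t) - v j t))\<^sup>2)"
proof -
  let ?p = "\<lambda>i j. weight \<psi> x i j (lag t)"
  have p: "0 \<le> ?p i j" "?p i j \<le> 1" for i j
    using weight_pos weight_le_1 lag_ge[of t] assms by (auto intro: less_imp_le)
  have pairs: "(\<Sum>i\<in>UNIV. \<Sum>j\<in>UNIV. (norm (v i t - v j t))\<^sup>2) = 2 * (real CARD('n))\<^sup>2 * velocity_variance v t"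
    by (simp add: velocity_variance_def)
  have fluct: "(\<Sum>i\<in>UNIV. (norm (v i t - mean (\<lambda>j. v j t)))\<^sup>2) = real CARD('n) * velocity_variance v t"
    by (simp add: velocity_variance_eq)
  show "(\<Sum>i\<in>UNIV. (norm (acc i t))\<^sup>2)
     \<le> 4 * real CARD('n) * lam\<^sup>2 * velocity_variance v t + 2 * lam\<^sup>2 * (\<Sum>j\<in>UNIV. (norm (v j (lag t) - v j t))\<^sup>2)"
    using sum_norm_sq_delayed_force_le[of ?p lam "\<lambda>j. v j (lag t)" "\<lambda>j. v j t", OF p]
    unfolding pairs acc_eq[OF assms] by (simp add: power2_eq_square mult.assoc mult.left_commute)
  have "\<gamma> * (\<Sum>i\<in>UNIV. \<Sum>j\<in>UNIV. (norm (v i t - v j t))\<^sup>2)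
       \<le> lam * (\<Sum>i\<in>UNIV. \<Sum>j\<in>UNIV. ?p i j * (norm (v i t - v j t))\<^sup>2)"
    by (rule laplacian_spectral_gap[OF lam_pos weight_pos fiedler fiedler_ge]) (use lag_gt[OF assms] in auto)
  from inner_fluctuation_delayed_force_le[of ?p, OF p weight_sym \<gamma>_pos this]
  show "2 * (\<Sum>i\<in>UNIV. (v i t - mean (\<lambda>j. v j t)) \<bullet> acc i t)
     \<le> - \<gamma> * real CARD('n) * velocity_variance v t + lam\<^sup>2 / \<gamma> * (\<Sum>j\<in>UNIV. (norm (v j (lag t) - v j t))\<^sup>2)"
    unfolding fluct acc_eq[OF assms] by (simp add: mult.assoc)
qed

text \<open>
  For positive times the acceleration need not be continuous, as the weights are arbitrary on the
  initial interval.  It is measurable as an integrable function, and bounded because velocities are bounded on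
  compact intervals.
\<close>

lemma acc_sq_integrable:
  assumes "- \<tau> 0 \<le> s"
  shows "(\<lambda>\<sigma>. (norm (acc i \<sigma>))\<^sup>2) integrable_on {s..t}"
proof -
  have past: "(\<lambda>\<sigma>. (norm (acc i \<sigma>))\<^sup>2) integrable_on {- \<tau> 0..0}"
  proof (rule integrable_spike)
    show "(\<lambda>\<sigma>. (norm (vector_derivative (g i) (at \<sigma>)))\<^sup>2) integrable_on {- \<tau> 0..0}"
      using data by (simp add: admissible_velocity_data_def)
    show "negligible {- \<tau> 0, 0}" by simp
  qed (auto simp: acc_data)
  define T where "T = max t 0"
  have future: "(\<lambda>\<sigma>. (norm (acc i \<sigma>))\<^sup>2) integrable_on {0..T}"
  proof -
    have "compact (\<Union>j. v j ` {- \<tau> 0..T})"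
      by (intro compact_UN compact_continuous_image continuous_on_subset[OF continuous_on_velocity]) auto
    then obtain K where "\<forall>y\<in>\<Union>j. v j ` {- \<tau> 0..T}. norm y \<le> K"
      using compact_imp_bounded bounded_iff by metis
    then have K: "norm (v j s) \<le> K" if "s \<in> {- \<tau> 0..T}" for j s using that by blast
    have diff: "(norm (v j r - v k s))\<^sup>2 \<le> (2 * K)\<^sup>2" if "r \<in> {- \<tau> 0..T}" "s \<in> {- \<tau> 0..T}" for j k r s
      using norm_triangle_ineq4[of "v j r" "v k s"] K[OF that(1), of j] K[OF that(2), of k] by (intro power_mono) auto
    show ?thesis
    proof (rule integrable_norm_sq_if_bounded)
      show "acc i integrable_on {0..T}"
        using acc_has_integral[of 0 T i] initial_delay_nonneg by (auto simp: T_def)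
      fix s assume s: "0 < s" "s \<le> T"
      have mem: "s \<in> {- \<tau> 0..T}" "lag s \<in> {- \<tau> 0..T}"
        using s initial_delay_nonneg lag_ge[of s] lag_le[of s] by auto
      have "(norm (acc i s))\<^sup>2 \<le> (\<Sum>i\<in>UNIV. (norm (acc i s))\<^sup>2)"
        by (rule member_le_sum) auto
      also have "\<dots> \<le> 4 * real CARD('n) * lam\<^sup>2 * velocity_variance v s + 2 * lam\<^sup>2 * (\<Sum>j\<in>UNIV. (norm (v j (lag s) - v j s))\<^sup>2)"
        by (rule delayed_force_bounds(1)[OF s(1)])
      also have "\<dots> \<le> 4 * real CARD('n) * lam\<^sup>2 * (1 / (2 * (real CARD('n))\<^sup>2) * (\<Sum>i\<in>(UNIV::'n set). \<Sum>j\<in>(UNIV::'n set). (2 * K)\<^sup>2))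
          + 2 * lam\<^sup>2 * (\<Sum>j\<in>(UNIV::'n set). (2 * K)\<^sup>2)"
        unfolding velocity_variance_def by (intro add_mono mult_left_mono sum_mono diff mem) auto
      finally show "(norm (acc i s))\<^sup>2 \<le> \<dots>" .
    qed
  qed
  have "(\<lambda>\<sigma>. (norm (acc i \<sigma>))\<^sup>2) integrable_on {- \<tau> 0..T}"
    using initial_delay_nonneg by (intro Henstock_Kurzweil_Integration.integrable_combine[OF _ _ past future]) (auto simp: T_def)
  then show ?thesis
    by (rule integrable_subinterval_real) (use assms in \<open>auto simp: T_def\<close>)
qed

definition path_energy :: "real \<Rightarrow> real" where
  "path_energy t = integral {- \<tau> 0..t} (\<lambda>\<sigma>. \<Sum>i\<in>UNIV. (norm (acc i \<sigma>))\<^sup>2)"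

lemma energy_integrable: "- \<tau> 0 \<le> s \<Longrightarrow> (\<lambda>\<sigma>. \<Sum>i\<in>UNIV. (norm (acc i \<sigma>))\<^sup>2) integrable_on {s..t}"
  by (intro integrable_sum acc_sq_integrable) auto

lemma path_energy_diff:
  assumes "- \<tau> 0 \<le> s" "s \<le> t"
  shows "path_energy t - path_energy s = integral {s..t} (\<lambda>\<sigma>. \<Sum>i\<in>UNIV. (norm (acc i \<sigma>))\<^sup>2)"
  using Henstock_Kurzweil_Integration.integral_combine[OF assms energy_integrable] by (simp add: path_energy_def)

lemma path_energy_mono: "- \<tau> 0 \<le> s \<Longrightarrow> s \<le> t \<Longrightarrow> path_energy s \<le> path_energy t"
  using path_energy_diff[of s t] integral_nonneg[OF energy_integrable[of s t]] by (simp add: sum_nonneg)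

lemma continuous_on_path_energy: "continuous_on {- \<tau> 0..} path_energy"
proof -
  have "continuous_on {- \<tau> 0..T} path_energy" for T
    unfolding path_energy_def by (intro indefinite_integral_continuous_1 energy_integrable) simp
  then show ?thesis by (rule continuous_on_Ici_if_Icc)
qed

lemma sum_displacement_sq_le:
  assumes "- \<tau> 0 \<le> s" "s \<le> t"
  shows "(\<Sum>j\<in>UNIV. (norm (v j s - v j t))\<^sup>2) \<le> (t - s) * (path_energy t - path_energy s)"
proof -
  have "(\<Sum>j\<in>UNIV. (norm (v j s - v j t))\<^sup>2) \<le> (\<Sum>j\<in>UNIV. (t - s) * integral {s..t} (\<lambda>\<sigma>. (norm (acc j \<sigma>))\<^sup>2))"
    by (intro sum_mono, subst norm_minus_commute)
       (rule cauchy_schwarz_integral[OF assms(2) acc_has_integral[OF assms] acc_sq_integrable[OF assms(1)]])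
  also have "\<dots> = (t - s) * (path_energy t - path_energy s)"
    by (simp add: path_energy_diff[OF assms] integral_sum acc_sq_integrable assms(1) sum_distrib_left)
  finally show ?thesis .
qed

lemma sum_lag_displacement_sq_le:
  assumes "0 < t"
  shows "(\<Sum>j\<in>UNIV. (norm (v j (lag t) - v j t))\<^sup>2) \<le> \<tau>bar * (path_energy t - path_energy (lag t))"
proof -
  have l: "- \<tau> 0 \<le> lag t" "lag t \<le> t" using lag_ge[of t] lag_le[of t] assms by auto
  have "(t - lag t) * (path_energy t - path_energy (lag t)) \<le> \<tau>bar * (path_energy t - path_energy (lag t))"
    using path_energy_mono[OF l] delay_bounds(2)[OF assms] by (intro mult_right_mono) (auto simp: lag_def)
  with sum_displacement_sq_le[OF l] show ?thesis by simp
qed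

definition energy_bound :: "real \<Rightarrow> real" where
  "energy_bound t = 4 * real CARD('n) * lam\<^sup>2 * velocity_variance v t + 2 * lam\<^sup>2 * \<tau>bar * (path_energy t - path_energy (lag t))"

text \<open>
  The accelerations appear on both sides, but on the right only integrated over the time window of the delay; this makes
  \<open>energy_bound\<close> continuous, hence a derivative of its integral.
\<close>

lemma sum_acc_sq_le: "0 < t \<Longrightarrow> (\<Sum>i\<in>UNIV. (norm (acc i t))\<^sup>2) \<le> energy_bound t"
  using delayed_force_bounds(1)[of t] mult_left_mono[OF sum_lag_displacement_sq_le[of t], of "2 * lam\<^sup>2"]
  by (simp add: energy_bound_def)

lemma velocity_variance_nonneg: "0 \<le> velocity_variance v t"
  unfolding velocity_variance_def by (intro mult_nonneg_nonneg sum_nonneg) auto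

lemma continuous_on_velocity_variance: "continuous_on {- \<tau> 0..} (velocity_variance v)"
  unfolding velocity_variance_def by (intro continuous_intros continuous_on_velocity)

lemma continuous_on_compose_lag:
  assumes "continuous_on {- \<tau> 0..} h"
  shows "continuous_on {0..} (\<lambda>t. h (lag t))"
  by (rule continuous_on_compose2[OF assms continuous_on_lag]) (use lag_ge in auto)

lemma continuous_on_energy_bound: "continuous_on {0..} energy_bound"
  unfolding energy_bound_def
  by (intro continuous_intros continuous_on_compose_lag continuous_on_path_energy
      continuous_on_subset[OF continuous_on_path_energy] continuous_on_subset[OF continuous_on_velocity_variance])
     (use initial_delay_nonneg in auto)

lemma path_energy_increment_le:
  assumes "0 < t" "0 \<le> h"
  shows "path_energy (t + h) \<le> path_energy t + integral {t..t + h} energy_bound"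
proof -
  have "integral {t..t + h} (\<lambda>\<sigma>. \<Sum>i\<in>UNIV. (norm (acc i \<sigma>))\<^sup>2) \<le> integral {t..t + h} energy_bound"
    using assms initial_delay_nonneg
    by (intro integral_le energy_integrable integrable_continuous_real continuous_on_subset[OF continuous_on_energy_bound] sum_acc_sq_le) auto
  with path_energy_diff[of t "t + h"] assms initial_delay_nonneg show ?thesis by simp
qed

text \<open>
  The weight of the memory functional for which the terms in the window integral of the squared
  accelerations cancel.
\<close>

definition lyapunov_weight :: real where
  "lyapunov_weight = lam\<^sup>2 * \<tau>bar / (\<gamma> * real CARD('n)) * (1 / ((1 - c) * exp (- \<tau>bar) - 2 * lam\<^sup>2 * \<tau>bar\<^sup>2))"

definition lyapunov :: "real \<Rightarrow> real" where
  "lyapunov t = velocity_variance v t + lyapunov_weight * memory path_energy (path_energy t) (lag t) t"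

lemma lyapunov_weight_nonneg: "0 \<le> lyapunov_weight"
  unfolding lyapunov_weight_def using small_delay \<gamma>_pos \<tau>bar_nonneg
  by (intro mult_nonneg_nonneg divide_nonneg_nonneg) auto

lemma memory_path_energy_nonneg:
  assumes "0 \<le> t"
  shows "0 \<le> memory path_energy (path_energy t) (lag t) t"
  using assms lag_ge[OF assms] by (intro memory_nonneg lag_le continuous_on_subset[OF continuous_on_path_energy] path_energy_mono) auto

lemma lyapunov_ge: "0 \<le> t \<Longrightarrow> velocity_variance v t \<le> lyapunov t"
  unfolding lyapunov_def using memory_path_energy_nonneg lyapunov_weight_nonneg by simp

text \<open>
  At time \<open>0\<close> the kernel \<open>exp (s - t)\<close> is \<open>exp s\<close>, and the window is the initial interval.
\<close>

lemma lyapunov_0: "lyapunov 0 = decay_constant lam \<gamma> c \<tau>bar \<tau> v"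
proof -
  have "memory path_energy (path_energy 0) (lag 0) 0
      = integral {- \<tau> 0..0} (\<lambda>s. exp (s - 0) * (path_energy 0 - path_energy s))"
    unfolding lag_0 using initial_delay_nonneg
    by (intro memory_eq_integral continuous_on_subset[OF continuous_on_path_energy]) auto
  also have "\<dots> = integral {- \<tau> 0..0} (\<lambda>s. exp s * integral {s..0}
            (\<lambda>\<sigma>. \<Sum>i\<in>UNIV. (norm (vector_derivative (v i) (at \<sigma>)))\<^sup>2))"
    by (rule integral_cong) (simp add: path_energy_diff acc_def)
  finally show ?thesis unfolding lyapunov_def decay_constant_def lyapunov_weight_def by simp
qed

text \<open>
  The window integral is a difference of values of one primitive \<open>Q\<close>, so that continuity of the window's endpoints suffices.
\<close>

lemma continuous_on_lyapunov: "continuous_on {0..} lyapunov"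
proof -
  have sub: "{0..} \<subseteq> {- \<tau> 0..}" using initial_delay_nonneg by auto
  define Q where "Q t = integral {- \<tau> 0..t} (\<lambda>s. exp s * path_energy s)" for t
  have cexp: "continuous_on {- \<tau> 0..} (\<lambda>s. exp s * path_energy s)"
    by (intro continuous_intros continuous_on_path_energy)
  have int: "(\<lambda>s. exp s * path_energy s) integrable_on {- \<tau> 0..t}" for t
    by (intro integrable_continuous_real continuous_on_subset[OF cexp]) auto
  have "continuous_on {- \<tau> 0..T} Q" for T
    unfolding Q_def by (rule indefinite_integral_continuous_1[OF int])
  then have Q: "continuous_on {- \<tau> 0..} Q" by (rule continuous_on_Ici_if_Icc)
  have "integral {lag t..t} (\<lambda>s. exp s * path_energy s) = Q t - Q (lag t)" if "0 \<le> t" for t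
    using Henstock_Kurzweil_Integration.integral_combine[OF lag_ge[OF that] lag_le[OF that] int] by (simp add: Q_def)
  moreover have "continuous_on {0..} (\<lambda>t. velocity_variance v t + lyapunov_weight *
      (exp (- t) * (path_energy t * (exp t - exp (lag t)) - (Q t - Q (lag t)))))"
    by (intro continuous_intros continuous_on_lag continuous_on_compose_lag Q continuous_on_subset[OF Q sub]
        continuous_on_subset[OF continuous_on_path_energy sub] continuous_on_subset[OF continuous_on_velocity_variance sub])
  ultimately show ?thesis
    unfolding lyapunov_def memory_def by (auto intro: continuous_on_eq)
qed

text \<open>
  The majorant combines the differentiable function \<open>V\<close> with the majorant of the memory term.  Its slope is \<open>V' + \<beta> G'\<close> with
  \<open>V' \<le> - \<gamma> V + lam\<^sup>2 \<tau>bar / (\<gamma> N) I\<close> and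
  \<open>G' \<le> 4 N lam\<^sup>2 \<tau>bar V - G - ((1 - c) exp (- \<tau>bar) - 2 lam\<^sup>2 \<tau>bar\<^sup>2) I\<close>, where \<open>I\<close> is the increment of \<open>path_energy\<close>
  over the window, and the choice of \<open>\<beta>\<close> makes \<open>I\<close> drop out.
\<close>

lemma lyapunov_majorant:
  assumes t: "0 < t"
  shows "\<exists>M m. M 0 = lyapunov t \<and> (M has_real_derivative m) (at_right 0) \<and>
     m \<le> - decay_rate lam \<gamma> c \<tau>bar * lyapunov t \<and> (\<forall>\<^sub>F h in at_right 0. lyapunov (t + h) \<le> M h)"
proof -
  let ?V = "velocity_variance v t" and ?G = "memory path_energy (path_energy t) (lag t) t"
    and ?I = "path_energy t - path_energy (lag t)" and ?\<beta> = lyapunov_weight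
    and ?K = "(1 - c) * exp (- \<tau>bar) - 2 * lam\<^sup>2 * \<tau>bar\<^sup>2"
  define b where "b h = path_energy t + integral {t..t + h} energy_bound" for h
  have "((\<lambda>s. integral {t..s} energy_bound) has_real_derivative energy_bound t) (at t within {t..t + 1})"
    using t by (intro integral_has_real_derivative continuous_on_subset[OF continuous_on_energy_bound]) auto
  moreover have "(+) t ` {0<..} = {t<..}"
  proof (rule set_eqI)
    show "s \<in> (+) t ` {0<..} \<longleftrightarrow> s \<in> {t<..}" for s
      using image_eqI[of s "(+) t" "s - t" "{0<..}"] by auto
  qed
  ultimately have "((\<lambda>s. integral {t..s} energy_bound) has_real_derivative energy_bound t) (at (t + 0) within (+) t ` {0<..})"
    by (simp add: at_within_Icc_at_right)
  moreover have "((+) t has_real_derivative 1) (at_right 0)"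
    by (auto intro!: derivative_eq_intros)
  ultimately have "((\<lambda>h. integral {t..t + h} energy_bound) has_real_derivative energy_bound t) (at_right 0)"
    using DERIV_image_chain by (fastforce simp: o_def)
  then have b: "(b has_real_derivative energy_bound t) (at_right 0)"
    unfolding b_def by (auto intro!: derivative_eq_intros)
  have "\<exists>M. M 0 = ?G \<and>
     (M has_real_derivative (1 - exp (lag t - t)) * energy_bound t - ?G - (1 - c) * exp (lag t - t) * ?I) (at_right 0) \<and>
     (\<forall>h\<ge>0. memory path_energy (path_energy (t + h)) (lag (t + h)) (t + h) \<le> M h)"
  proof (rule memory_majorant[where l = lag and t = t, OF continuous_on_path_energy path_energy_mono lag_gt[OF t] _ _ _ b])
    show "lag t \<le> t" using t by (simp add: lag_le)
    show "0 \<le> 1 - c" using c_less_1 by simp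
    show "lag t + (1 - c) * h \<le> lag (t + h) \<and> lag (t + h) \<le> t + h" if "0 \<le> h" for h
      using t that lag_lower lag_le by simp
    show "b 0 = path_energy t" by (simp add: b_def)
    show "path_energy (t + h) \<le> b h" if "0 \<le> h" for h
      unfolding b_def using path_energy_increment_le[OF t that] .
  qed
  then obtain M where M0: "M 0 = ?G"
    and M': "(M has_real_derivative (1 - exp (lag t - t)) * energy_bound t - ?G - (1 - c) * exp (lag t - t) * ?I) (at_right 0)"
    and M: "\<And>h. 0 \<le> h \<Longrightarrow> memory path_energy (path_energy (t + h)) (lag (t + h)) (t + h) \<le> M h"
    by blast
  define V' where "V' = 2 / real CARD('n) * (\<Sum>i\<in>UNIV. (v i t - mean (\<lambda>j. v j t)) \<bullet> acc i t)"
  have "(velocity_variance v has_real_derivative V') (at t)"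
    unfolding V'_def using has_vector_derivative_velocity[OF t]
    by (intro has_real_derivative_velocity_variance) (simp add: acc_eq[OF t])
  then have "((\<lambda>h. velocity_variance v (t + h)) has_real_derivative V' * 1) (at 0 within {0<..})"
    by (intro DERIV_chain2[where g = "\<lambda>h. t + h"]) (auto intro!: derivative_eq_intros)
  then have V: "((\<lambda>h. velocity_variance v (t + h)) has_real_derivative V') (at_right 0)" by simp
  define m where "m = V' + ?\<beta> * ((1 - exp (lag t - t)) * energy_bound t - ?G - (1 - c) * exp (lag t - t) * ?I)"
  have I: "0 \<le> ?I" using path_energy_mono[of "lag t" t] lag_ge lag_le t by simp
  have G: "0 \<le> ?G" using memory_path_energy_nonneg t by simp
  have V'_le: "V' \<le> - \<gamma> * ?V + lam\<^sup>2 * \<tau>bar / (\<gamma> * real CARD('n)) * ?I"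
  proof -
    have "2 * (\<Sum>i\<in>UNIV. (v i t - mean (\<lambda>j. v j t)) \<bullet> acc i t) \<le> - \<gamma> * real CARD('n) * ?V + lam\<^sup>2 / \<gamma> * (\<tau>bar * ?I)"
      using delayed_force_bounds(2)[OF t] mult_left_mono[OF sum_lag_displacement_sq_le[OF t], of "lam\<^sup>2 / \<gamma>"] \<gamma>_pos by simp
    then have "V' \<le> (- \<gamma> * real CARD('n) * ?V + lam\<^sup>2 / \<gamma> * (\<tau>bar * ?I)) / real CARD('n)"
      unfolding V'_def by (simp add: divide_right_mono)
    also have "\<dots> = - \<gamma> * ?V + lam\<^sup>2 * \<tau>bar / (\<gamma> * real CARD('n)) * ?I"
      using \<gamma>_pos by (simp add: field_simps)
    finally show ?thesis .
  qed
  have "m \<le> - decay_rate lam \<gamma> c \<tau>bar * lyapunov t"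
  proof -
    have ex: "0 \<le> 1 - exp (lag t - t)" "1 - exp (lag t - t) \<le> \<tau>bar" "exp (- \<tau>bar) \<le> exp (lag t - t)"
      using exp_ge_add_one_self[of "lag t - t"] delay_bounds[OF t] by (auto simp: lag_def)
    have B: "0 \<le> energy_bound t"
      unfolding energy_bound_def using I \<tau>bar_nonneg velocity_variance_nonneg[of t] by simp
    have "(1 - exp (lag t - t)) * energy_bound t - ?G - (1 - c) * exp (lag t - t) * ?I
       \<le> \<tau>bar * energy_bound t - ?G - (1 - c) * exp (- \<tau>bar) * ?I"
      using ex B I c_less_1 by (intro diff_mono mult_right_mono mult_left_mono) auto
    also have "\<dots> = 4 * real CARD('n) * lam\<^sup>2 * \<tau>bar * ?V - ?G - ?K * ?I"
      by (simp add: energy_bound_def algebra_simps power2_eq_square)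
    finally have "m \<le> - \<gamma> * ?V + lam\<^sup>2 * \<tau>bar / (\<gamma> * real CARD('n)) * ?I + ?\<beta> * (4 * real CARD('n) * lam\<^sup>2 * \<tau>bar * ?V - ?G - ?K * ?I)"
      unfolding m_def by (intro add_mono V'_le mult_left_mono lyapunov_weight_nonneg)
    also have "\<dots> = - (\<gamma> - 4 * real CARD('n) * lam\<^sup>2 * \<tau>bar * ?\<beta>) * ?V - ?\<beta> * ?G + (lam\<^sup>2 * \<tau>bar / (\<gamma> * real CARD('n)) - ?\<beta> * ?K) * ?I"
      by (simp add: algebra_simps)
    \<comment> \<open>The defining property of the weight \<open>\<beta>\<close>.\<close>
    also have "lam\<^sup>2 * \<tau>bar / (\<gamma> * real CARD('n)) - ?\<beta> * ?K = 0"
      using small_delay by (simp add: lyapunov_weight_def)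
    also have "4 * real CARD('n) * lam\<^sup>2 * \<tau>bar * ?\<beta> = 4 * (lam\<^sup>2 / \<gamma>) * (lam\<^sup>2 * \<tau>bar\<^sup>2 / ?K)"
      by (simp add: lyapunov_weight_def power2_eq_square)
    finally have "m \<le> - (\<gamma> - 4 * (lam\<^sup>2 / \<gamma>) * (lam\<^sup>2 * \<tau>bar\<^sup>2 / ?K)) * ?V - 1 * (?\<beta> * ?G)" by simp
    \<comment> \<open>Both \<open>V\<close> and \<open>\<beta> G\<close> are nonnegative, so each coefficient may be lowered to the common rate.\<close>
    also have "\<dots> \<le> - decay_rate lam \<gamma> c \<tau>bar * ?V - decay_rate lam \<gamma> c \<tau>bar * (?\<beta> * ?G)"
      unfolding decay_rate_def using velocity_variance_nonneg G lyapunov_weight_nonneg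
      by (intro diff_mono mult_right_mono mult_nonneg_nonneg) auto
    also have "\<dots> = - decay_rate lam \<gamma> c \<tau>bar * lyapunov t" by (simp add: lyapunov_def algebra_simps)
    finally show ?thesis .
  qed
  moreover have "((\<lambda>h. velocity_variance v (t + h) + ?\<beta> * M h) has_real_derivative m) (at_right 0)"
    unfolding m_def by (intro DERIV_add V DERIV_cmult M')
  moreover have "\<forall>\<^sub>F h in at_right 0. lyapunov (t + h) \<le> velocity_variance v (t + h) + ?\<beta> * M h"
    using eventually_at_right_less[of "0::real"]
    by eventually_elim (simp add: lyapunov_def M mult_left_mono lyapunov_weight_nonneg)
  ultimately show ?thesis
    by (intro exI[of _ "\<lambda>h. velocity_variance v (t + h) + ?\<beta> * M h"] exI[of _ m]) (simp add: lyapunov_def M0)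
qed

lemma velocity_variance_decay:
  assumes "0 \<le> t"
  shows "velocity_variance v t \<le> decay_constant lam \<gamma> c \<tau>bar \<tau> v * exp (- decay_rate lam \<gamma> c \<tau>bar * t)"
proof -
  have "lyapunov t \<le> lyapunov 0 * exp (- decay_rate lam \<gamma> c \<tau>bar * t)"
    by (rule gronwall_majorant[OF assms]) (use lyapunov_majorant in \<open>auto intro: continuous_on_subset[OF continuous_on_lyapunov]\<close>)
  with lyapunov_ge[OF assms] show ?thesis by (simp add: lyapunov_0)
qed

end

text \<open>
  For \<open>lam = 0\<close> the critical delay is \<open>0\<close>, since division by zero yields zero, and no delay lies below it.
  Otherwise it is at most \<open>(1 - c) / (2 lam\<^sup>2)\<close>, which makes the denominators in rate and constant
  positive.
\<close>

lemma below_critical_delay: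
  assumes "c < 1" and "\<tau>bar\<^sup>2 * exp \<tau>bar \<in> {0<..<critical_delay lam \<gamma> c}"
  shows "lam \<noteq> 0" and "0 < (1 - c) * exp (- \<tau>bar) - 2 * lam\<^sup>2 * \<tau>bar\<^sup>2"
proof -
  show lam: "lam \<noteq> 0" using assms(2) by (auto simp: critical_delay_def)
  have pos: "0 < 2 * lam\<^sup>2 + \<gamma>\<^sup>2" using lam by (simp add: add_pos_nonneg)
  have "critical_delay lam \<gamma> c = (1 - c) / (2 * lam\<^sup>2) * (\<gamma>\<^sup>2 / (2 * lam\<^sup>2 + \<gamma>\<^sup>2))"
    by (simp add: critical_delay_def)
  also have "\<dots> \<le> (1 - c) / (2 * lam\<^sup>2) * 1"
    using assms(1) pos by (intro mult_left_mono) (auto simp: divide_le_eq)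
  finally have "\<tau>bar\<^sup>2 * exp \<tau>bar < (1 - c) / (2 * lam\<^sup>2)" using assms(2) by simp
  then have "2 * lam\<^sup>2 * (\<tau>bar\<^sup>2 * exp \<tau>bar) < 1 - c" using lam by (simp add: field_simps)
  then have "2 * lam\<^sup>2 * (\<tau>bar\<^sup>2 * exp \<tau>bar) * exp (- \<tau>bar) < (1 - c) * exp (- \<tau>bar)"
    by (rule mult_strict_right_mono) simp
  moreover have "2 * lam\<^sup>2 * (\<tau>bar\<^sup>2 * exp \<tau>bar) * exp (- \<tau>bar) = 2 * lam\<^sup>2 * \<tau>bar\<^sup>2"
    by (simp add: exp_minus)
  ultimately show "0 < (1 - c) * exp (- \<tau>bar) - 2 * lam\<^sup>2 * \<tau>bar\<^sup>2"
    by simp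
qed

theorem theorem2p1:
  fixes lam \<gamma> c \<tau>bar :: real
    and \<tau> \<psi> \<mu> :: "real \<Rightarrow> real"
    and f g x v :: "'n::finite \<Rightarrow> real \<Rightarrow> real ^ 'd"
  assumes "0 \<le> lam"
    and "0 < \<tau>bar" and "0 < c" and "c < 1"
    and "admissible_delay \<tau>bar c \<tau>"
    and "admissible_potential \<psi>"
    and "admissible_velocity_data \<tau> g"
    and "delayed_CS_solution lam \<psi> \<tau> f g x v"
    and "\<And>i j t. - \<tau> 0 \<le> t \<Longrightarrow> weight \<psi> x i j t \<le> 1"
    and "\<And>t. - \<tau> 0 < t \<Longrightarrow> is_fiedler_number (laplacian lam \<psi> x t) (\<mu> t)"
    and "0 < \<gamma>"
    \<comment> \<open>Also on the initial interval: the weights acting at time \<open>t > 0\<close> are those at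
        \<open>t - \<tau> t\<close>, which ranges over \<open>(- \<tau> 0, \<infinity>)\<close>.\<close>
    and "\<And>t. - \<tau> 0 < t \<Longrightarrow> \<gamma> \<le> \<mu> t"
    and "\<tau>bar\<^sup>2 * exp \<tau>bar \<in> {0<..<critical_delay lam \<gamma> c}"
  shows "\<forall>t\<ge>0. velocity_variance v t
           \<le> decay_constant lam \<gamma> c \<tau>bar \<tau> v * exp (- decay_rate lam \<gamma> c \<tau>bar * t)"
proof -
  note critical = below_critical_delay[OF assms(4,13)]
  interpret delayed_flock lam \<gamma> c \<tau>bar \<tau> \<psi> \<mu> f g x v
    using assms critical by unfold_locales auto
  show ?thesis using velocity_variance_decay by blast
qed

end
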